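(* Let $\mathcal{T}$ be a random dynamical system on $X$ over $(\Omega,\mathcal{B}(\Omega),\mathbb{P},\vartheta)$ with a stationary measure $\mu$. If the random dynamical system has a super-polynomial decay of correlations, then \[\underline{R}^{\omega}(x)=\underline{d}_\mu(x)\qquad\text{and}\qquad\overline{R}^{\omega}(x)=\overline{d}_\mu(x)\] for $\mathbb{P}\otimes\mu$-almost every $(\omega,x)\in\Omega\times X$ such that $\underline{d}_\mu(x)>0$.
   Context: Random dynamical system: $\Omega$ is a metric space with Borel $\sigma$-algebra $\mathcal{B}(\Omega)$, $\mathbb{P}$ is a probability measure on $(\Omega,\mathcal{B}(\Omega))$, and $\vartheta:\Omega\to\Omega$ is a measurable $\mathbb{P}$-preserving map. $X$ is a compact Riemannian manifold with distance $d$, and $B(x,r)$ denotes the open ball. A family of maps $T_\omega:X\to X$, $\omega\in\Omega$, is given such that $(\omega,x)\mapsto T_\omega x$ is measurable. For $n\ge 1$ set $T^n_\omega:=T_{\vartheta^{n-1}\omega}\circ\cdots\circ T_{\vartheta\omega}\circ T_\omega$ (and $T^0_\omega=\mathrm{id}$), so that $T^{n+m}_\omega=T^n_{\vartheta^m\omega}\circ T^m_\omega$. These data form the random dynamical system $\mathcal{T}$ on $X$ over $(\Omega,\mathcal{B}(\Omega),\mathbb{P},\vartheta)$. Stationary measure: the skew product is $S:\Omega\times X\to\Omega\times X$, $S(\omega,x)=(\vartheta\omega,T_\omega x)$. A Borel probability measure $\mu$ on $X$ is stationary if $\mathbb{P}\otimes\mu$ is $S$-invariant. Non-instantaneous quenched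 return times and recurrence rates: for $r>0$, $p\in\mathbb{N}=\{0,1,2,\dots\}$, \[\tau^{\omega}_{r,p}(x):=\inf\{k>p: d(T^k_\omega x,x)<r\}\] (with $\inf\emptyset=+\infty$, $\log(+\infty)=+\infty$), and \[\underline{R}^{\omega}(x):=\lim_{p\to\infty}\liminf_{r\to0}\frac{\log\tau_{r,p}^{\omega}(x)}{-\log r},\qquad \overline{R}^{\omega}(x):=\lim_{p\to\infty}\limsup_{r\to0}\frac{\log\tau_{r,p}^{\omega}(x)}{-\log r}.\] Local dimensions: $\underline{d}_\mu(x)=\liminf_{r\to0}\frac{\log\mu(B(x,r))}{\log r}$ and $\overline{d}_\mu(x)=\limsup_{r\to0}\frac{\log\mu(B(x,r))}{\log r}$. Super-polynomial decay of correlations: there is a sequence $(\theta_n)_{n\ge1}$ with $\lim_{n\to\infty}\theta_n n^p=0$ for every $p>0$ such that for all $n\ge1$ and all Lipschitz functions $\psi,\varphi:X\to\mathbb{R}$ \[\left|\int_X\int_\Omega \psi(T^n_\omega x)\varphi(x)\,d\mathbb{P}(\omega)\,d\mu(x)-\int_X\psi\,d\mu\int_X\varphi\,d\mu\right|\le\|\psi\|\,\|\varphi\|\,\theta_n,\] where $\|\cdot\|$ is the Lipschitz norm. *)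

theory Defs
  imports "HOL-Probability.Probability_Measure"
begin

section \<open>Compact Riemannian manifolds\<close>

fun Ck_on :: "nat \<Rightarrow> 'a::real_normed_vector set \<Rightarrow> ('a \<Rightarrow> 'b::real_normed_vector) \<Rightarrow> bool" where
  "Ck_on 0 S f \<longleftrightarrow> continuous_on S f"
| "Ck_on (Suc k) S f \<longleftrightarrow>
     (\<forall>x\<in>S. f differentiable (at x)) \<and> (\<forall>v. Ck_on k S (\<lambda>x. frechet_derivative f (at x) v))"

text \<open>Only meant for open sets.\<close>

definition smooth_on :: "'a::real_normed_vector set \<Rightarrow> ('a \<Rightarrow> 'b::real_normed_vector) \<Rightarrow> bool" where
  "smooth_on S f \<longleftrightarrow> (\<forall>k. Ck_on k S f)"

text \<open>A chart is a pair of its domain and its coordinate map; the coordinate map is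
  irrelevant outside the domain.\<close>

type_synonym ('x, 'e) chart = "'x set \<times> ('x \<Rightarrow> 'e)"

definition is_chart :: "('x::topological_space, 'e::euclidean_space) chart \<Rightarrow> bool" where
  "is_chart = (\<lambda>(U, \<phi>). open U \<and> open (\<phi> ` U) \<and> homeomorphism U (\<phi> ` U) \<phi> (inv_into U \<phi>))"

definition transition ::
    "('x, 'e) chart \<Rightarrow> ('x, 'e) chart \<Rightarrow> 'e \<Rightarrow> 'e" where
  "transition c c' = snd c' \<circ> inv_into (fst c) (snd c)"

definition smooth_atlas :: "('x::topological_space, 'e::euclidean_space) chart set \<Rightarrow> bool" where
  "smooth_atlas A \<longleftrightarrow>
     (\<forall>c\<in>A. is_chart c) \<and> (\<Union>c\<in>A. fst c) = UNIV \<and>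
     (\<forall>c\<in>A. \<forall>c'\<in>A. smooth_on (snd c ` (fst c \<inter> fst c')) (transition c c'))"

text \<open>A Riemannian metric is given by its local expressions: \<open>g c y\<close> is the inner product
  on tangent vectors at the point with coordinates \<open>y\<close>, written in the chart \<open>c\<close>.
  The last condition is the transformation law of a covariant 2-tensor.\<close>

definition riemannian_metric ::
    "('x::topological_space, 'e::euclidean_space) chart set \<Rightarrow>
     (('x, 'e) chart \<Rightarrow> 'e \<Rightarrow> 'e \<Rightarrow> 'e \<Rightarrow> real) \<Rightarrow> bool" where
  "riemannian_metric A g \<longleftrightarrow>
     (\<forall>c\<in>A. \<forall>y\<in>snd c ` fst c.
        bilinear (g c y) \<and> (\<forall>v w. g c y v w = g c y w v) \<and> (\<forall>v. v \<noteq> 0 \<longrightarrow> g c y v v > 0)) \<and>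
     (\<forall>c\<in>A. \<forall>v w. smooth_on (snd c ` fst c) (\<lambda>y. g c y v w)) \<and>
     (\<forall>c\<in>A. \<forall>c'\<in>A. \<forall>x\<in>fst c \<inter> fst c'. \<forall>v w.
        g c (snd c x) v w =
          (let D = frechet_derivative (transition c c') (at (snd c x))
           in g c' (snd c' x) (D v) (D w)))"

text \<open>The derivatives at the end points are one-sided.\<close>

definition C1_curve_on ::
    "('x::topological_space, 'e::euclidean_space) chart set \<Rightarrow> real set \<Rightarrow> (real \<Rightarrow> 'x) \<Rightarrow> bool" where
  "C1_curve_on A I \<gamma> \<longleftrightarrow>
     continuous_on I \<gamma> \<and>
     (\<forall>(U, \<phi>)\<in>A. \<exists>D. continuous_on (I \<inter> \<gamma> -` U) D \<and>
        (\<forall>t\<in>I \<inter> \<gamma> -` U. ((\<phi> \<circ> \<gamma>) has_vector_derivative D t) (at t within I)))"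

text \<open>The finite set \<open>F\<close> contains the break points.\<close>

definition piecewise_C1_curve ::
    "('x::topological_space, 'e::euclidean_space) chart set \<Rightarrow> (real \<Rightarrow> 'x) \<Rightarrow> bool" where
  "piecewise_C1_curve A \<gamma> \<longleftrightarrow>
     (\<exists>F. finite F \<and>
        (\<forall>a b. 0 \<le> a \<and> a < b \<and> b \<le> 1 \<and> {a<..<b} \<inter> F = {} \<longrightarrow> C1_curve_on A {a..b} \<gamma>))"

text \<open>By the transformation law of \<open>g\<close> the speed does not depend on the selected chart,
  except possibly at the finitely many break points.\<close>

definition speed ::
    "('x::topological_space, 'e::euclidean_space) chart set \<Rightarrow>
     (('x, 'e) chart \<Rightarrow> 'e \<Rightarrow> 'e \<Rightarrow> 'e \<Rightarrow> real) \<Rightarrow> (real \<Rightarrow> 'x) \<Rightarrow> real \<Rightarrow> real" where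
  "speed A g \<gamma> t =
     (let c = (SOME c. c \<in> A \<and> \<gamma> t \<in> fst c);
          v = vector_derivative (snd c \<circ> \<gamma>) (at t within {0..1})
      in sqrt (g c (snd c (\<gamma> t)) v v))"

definition curve_length ::
    "('x::topological_space, 'e::euclidean_space) chart set \<Rightarrow>
     (('x, 'e) chart \<Rightarrow> 'e \<Rightarrow> 'e \<Rightarrow> 'e \<Rightarrow> real) \<Rightarrow> (real \<Rightarrow> 'x) \<Rightarrow> real" where
  "curve_length A g \<gamma> = integral {0..1} (speed A g \<gamma>)"

definition curves_between ::
    "('x::topological_space, 'e::euclidean_space) chart set \<Rightarrow> 'x \<Rightarrow> 'x \<Rightarrow> (real \<Rightarrow> 'x) set" where
  "curves_between A x y = {\<gamma>. piecewise_C1_curve A \<gamma> \<and> \<gamma> 0 = x \<and> \<gamma> 1 = y}"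

text \<open>The whole type is a compact manifold without boundary, modelled on the Euclidean space
  \<open>'e\<close>, and \<open>dist\<close> is its Riemannian distance. Connectedness is not required: on a
  connected manifold any two points are joined by a piecewise \<open>C\<^sup>1\<close> curve, so \<open>dist\<close> is
  the usual infimum of lengths; between different components, where the usual infimum is
  infinite, \<open>dist\<close> may take any finite values compatible with the manifold topology.\<close>

definition compact_riemannian_manifold ::
    "('x::metric_space, 'e::euclidean_space) chart set \<Rightarrow>
     (('x, 'e) chart \<Rightarrow> 'e \<Rightarrow> 'e \<Rightarrow> 'e \<Rightarrow> real) \<Rightarrow> bool" where
  "compact_riemannian_manifold A g \<longleftrightarrow>
     compact (UNIV :: 'x set) \<and> smooth_atlas A \<and> riemannian_metric A g \<and>
     (\<forall>x y. curves_between A x y \<noteq> {} \<longrightarrow>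
        dist x y = (INF \<gamma>\<in>curves_between A x y. curve_length A g \<gamma>))"

section \<open>Random dynamical systems\<close>

definition random_dynamical_system ::
    "'w::metric_space measure \<Rightarrow> ('w \<Rightarrow> 'w) \<Rightarrow> ('w \<Rightarrow> 'x::metric_space \<Rightarrow> 'x) \<Rightarrow> bool" where
  "random_dynamical_system P \<theta> T \<longleftrightarrow>
     prob_space P \<and> sets P = sets borel \<and>
     \<theta> \<in> measurable P P \<and> distr P P \<theta> = P \<and>
     (\<lambda>(\<omega>, x). T \<omega> x) \<in> measurable (P \<Otimes>\<^sub>M borel) borel"

primrec rds_iter :: "('w \<Rightarrow> 'w) \<Rightarrow> ('w \<Rightarrow> 'x \<Rightarrow> 'x) \<Rightarrow> nat \<Rightarrow> 'w \<Rightarrow> 'x \<Rightarrow> 'x" where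
  "rds_iter \<theta> T 0 \<omega> x = x"
| "rds_iter \<theta> T (Suc n) \<omega> x = T ((\<theta> ^^ n) \<omega>) (rds_iter \<theta> T n \<omega> x)"

definition skew_product :: "('w \<Rightarrow> 'w) \<Rightarrow> ('w \<Rightarrow> 'x \<Rightarrow> 'x) \<Rightarrow> 'w \<times> 'x \<Rightarrow> 'w \<times> 'x" where
  "skew_product \<theta> T = (\<lambda>(\<omega>, x). (\<theta> \<omega>, T \<omega> x))"

definition stationary_measure ::
    "'w::metric_space measure \<Rightarrow> ('w \<Rightarrow> 'w) \<Rightarrow> ('w \<Rightarrow> 'x::metric_space \<Rightarrow> 'x) \<Rightarrow> 'x measure \<Rightarrow> bool" where
  "stationary_measure P \<theta> T \<mu> \<longleftrightarrow>
     prob_space \<mu> \<and> sets \<mu> = sets borel \<and>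
     distr (P \<Otimes>\<^sub>M \<mu>) (P \<Otimes>\<^sub>M \<mu>) (skew_product \<theta> T) = P \<Otimes>\<^sub>M \<mu>"

section \<open>Recurrence rates and local dimensions\<close>

definition elog :: "ereal \<Rightarrow> ereal" where
  "elog a = (if a = \<infinity> then \<infinity> else if a \<le> 0 then - \<infinity> else ereal (ln (real_of_ereal a)))"

definition return_time ::
    "('w \<Rightarrow> 'w) \<Rightarrow> ('w \<Rightarrow> 'x::metric_space \<Rightarrow> 'x) \<Rightarrow> real \<Rightarrow> nat \<Rightarrow> 'w \<Rightarrow> 'x \<Rightarrow> enat" where
  "return_time \<theta> T r p \<omega> x = Inf {enat k | k. k > p \<and> dist (rds_iter \<theta> T k \<omega> x) x < r}"

definition lower_recurrence_rate ::
    "('w \<Rightarrow> 'w) \<Rightarrow> ('w \<Rightarrow> 'x::metric_space \<Rightarrow> 'x) \<Rightarrow> 'w \<Rightarrow> 'x \<Rightarrow> ereal" where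
  "lower_recurrence_rate \<theta> T \<omega> x =
     lim (\<lambda>p. Liminf (at_right 0)
       (\<lambda>r. elog (ereal_of_enat (return_time \<theta> T r p \<omega> x)) / ereal (- ln r)))"

definition upper_recurrence_rate ::
    "('w \<Rightarrow> 'w) \<Rightarrow> ('w \<Rightarrow> 'x::metric_space \<Rightarrow> 'x) \<Rightarrow> 'w \<Rightarrow> 'x \<Rightarrow> ereal" where
  "upper_recurrence_rate \<theta> T \<omega> x =
     lim (\<lambda>p. Limsup (at_right 0)
       (\<lambda>r. elog (ereal_of_enat (return_time \<theta> T r p \<omega> x)) / ereal (- ln r)))"

definition lower_local_dim :: "'x::metric_space measure \<Rightarrow> 'x \<Rightarrow> ereal" where
  "lower_local_dim \<mu> x =
     Liminf (at_right 0) (\<lambda>r. elog (ereal (measure \<mu> (ball x r))) / ereal (ln r))"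

definition upper_local_dim :: "'x::metric_space measure \<Rightarrow> 'x \<Rightarrow> ereal" where
  "upper_local_dim \<mu> x =
     Limsup (at_right 0) (\<lambda>r. elog (ereal (measure \<mu> (ball x r))) / ereal (ln r))"

section \<open>Decay of correlations\<close>

definition is_lipschitz :: "('x::metric_space \<Rightarrow> real) \<Rightarrow> bool" where
  "is_lipschitz f \<longleftrightarrow> (\<exists>C. C-lipschitz_on UNIV f)"

text \<open>Sup norm plus least Lipschitz constant; the diagonal contributes \<open>0 / 0 = 0\<close>.
  Only meaningful for bounded Lipschitz functions.\<close>

definition lipschitz_norm :: "('x::metric_space \<Rightarrow> real) \<Rightarrow> real" where
  "lipschitz_norm f = (SUP x. \<bar>f x\<bar>) + (SUP (x, y). \<bar>f x - f y\<bar> / dist x y)"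

definition super_polynomial_decay ::
    "'w::metric_space measure \<Rightarrow> ('w \<Rightarrow> 'w) \<Rightarrow> ('w \<Rightarrow> 'x::metric_space \<Rightarrow> 'x) \<Rightarrow> 'x measure \<Rightarrow> bool" where
  "super_polynomial_decay P \<theta> T \<mu> \<longleftrightarrow>
     (\<exists>\<delta> :: nat \<Rightarrow> real.
        (\<forall>p>0. (\<lambda>n. \<delta> n * real n powr p) \<longlonglongrightarrow> 0) \<and>
        (\<forall>n\<ge>1. \<forall>\<psi> \<phi>. is_lipschitz \<psi> \<and> is_lipschitz \<phi> \<longrightarrow>
           \<bar>(\<integral>x. (\<integral>\<omega>. \<psi> (rds_iter \<theta> T n \<omega> x) * \<phi> x \<partial>P) \<partial>\<mu>) - (\<integral>x. \<psi> x \<partial>\<mu>) * (\<integral>x. \<phi> x \<partial>\<mu>)\<bar>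
             \<le> lipschitz_norm \<psi> * lipschitz_norm \<phi> * \<delta> n))"

end

theory Submission
  imports Defs
begin

text \<open>
  Let \<open>S\<close> be the skew product acting on \<open>P \<Otimes>\<^sub>M \<mu>\<close>, and write \<open>w r x\<close> for the measure of \<open>ball x r\<close>.
  Both inequalities between recurrence rates and local dimensions follow from a bound, by a power of
  \<open>r\<close>, on the probability that \<open>(\<omega>, x)\<close> returns to \<open>ball x r\<close> too late or too early. Along the
  scales \<open>r = 5^(-n)\<close> such bounds are summable, so by Borel and Cantelli almost every point is
  exceptional at only finitely many scales; the remaining step is deterministic.

  The bad sets are measured by averaging over centres (\<open>emeasure_le_by_averaging\<close>). Because
  \<open>1 = \<integral> indicator (ball x r) y / w r x d\<mu>(y)\<close>, Fubini shows that a set \<open>E\<close> has measure at most \<open>c\<close> as soon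
  as, for each fixed centre \<open>y\<close>, the integral of \<open>1 / w r x\<close> over those points of \<open>E\<close> with
  \<open>dist x y < r\<close> is at most \<open>c\<close>. This replaces the usual covering by balls of bounded overlap.

  For late returns, Kac's inequality says that the return time to a set has integral at most \<open>1\<close> over
  that set. If a point of \<open>ball y r\<close> does not return to \<open>ball x (2 * r)\<close> before time \<open>t = r powr (-e) / w r x\<close>,
  then its return time to \<open>ball y r\<close> exceeds \<open>t\<close>, and the weight \<open>1 / w r x\<close> is \<open>r powr e * t\<close>.
  So the averaged integral is at most \<open>r powr e\<close> (\<open>emeasure_late_return\<close>). Working with \<open>S ^^ Suc p\<close>
  instead of \<open>S\<close> ignores the returns up to time \<open>p\<close>. Hence the recurrence rates are at most the dimensions.

  For early returns, decay of correlations shows that the points that are in \<open>ball y (2 * r)\<close> both at time \<open>0\<close> and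
  at time \<open>k\<close> have measure at most \<open>b\<^sup>2 + (1 / r)\<^sup>2 * \<bar>\<delta> k\<bar>\<close> with \<open>b\<close> the measure of \<open>ball y (4 * r)\<close>.
  For \<open>k\<close> between \<open>r powr (-e)\<close> and \<open>r powr (2 * e) / w (5 * r) x\<close> the second term is negligible and the
  sum over \<open>k\<close> is small (\<open>emeasure_early_return\<close>), provided that \<open>w r x \<ge> r powr D\<close> for a fixed \<open>D\<close> and that
  \<open>w (5 * r) x \<le> r powr (-e) * w r x\<close>. The first proviso holds almost surely at all small scales because a
  compact manifold is covered by \<open>O(r^(-dim))\<close> balls of radius \<open>r\<close>; for this it is enough that inverse charts
  are Lipschitz on small balls (\<open>manifold_covered_polynomially\<close>). The second proviso then fails only rarely:
  every failure at scale \<open>5^(-n)\<close> costs a factor \<open>5^(-e*n)\<close> of measure, of which only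
  \<open>5^(-D*n)\<close> is available, so the gaps between good scales are bounded (\<open>steady_scale_gaps\<close>), and bounded
  gaps do not change logarithmic limits.

  Return times \<open>k < r powr (-e)\<close> are excluded by looking at a larger good scale \<open>s\<close> with
  \<open>s powr (-e) \<le> k \<le> s powr (-2 * e)\<close>: if the lower local dimension exceeds \<open>4 * e\<close>, such \<open>k\<close>
  is in the range treated at scale \<open>s\<close>, up to a constant factor. A scale \<open>s\<close> of this kind exists when \<open>k\<close> is large,
  and discarding the first \<open>p\<close> iterates makes \<open>k\<close> large.
\<close>

section \<open>Covering numbers of a compact Riemannian manifold\<close>

definition covered_polynomially :: "nat \<Rightarrow> 'x::metric_space set \<Rightarrow> bool" where
  "covered_polynomially n V \<longleftrightarrow> (\<exists>C\<ge>0. \<forall>r. 0 < r \<and> r < 1 \<longrightarrow>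
     (\<exists>S. finite S \<and> real (card S) \<le> C * (1 / r) ^ n \<and> V \<subseteq> (\<Union>s\<in>S. ball s r)))"

lemma covered_polynomially_subset:
  "covered_polynomially n V \<Longrightarrow> W \<subseteq> V \<Longrightarrow> covered_polynomially n W"
  unfolding covered_polynomially_def by (meson subset_trans)

lemma covered_polynomially_Un:
  assumes "covered_polynomially n V" "covered_polynomially n W"
  shows "covered_polynomially n (V \<union> W)"
proof -
  obtain C1 where C1: "C1 \<ge> 0" "\<And>r. 0 < r \<Longrightarrow> r < 1 \<Longrightarrow>
     \<exists>S. finite S \<and> real (card S) \<le> C1 * (1 / r) ^ n \<and> V \<subseteq> (\<Union>s\<in>S. ball s r)"
    using assms(1) unfolding covered_polynomially_def by auto
  obtain C2 where C2: "C2 \<ge> 0" "\<And>r. 0 < r \<Longrightarrow> r < 1 \<Longrightarrow>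
     \<exists>S. finite S \<and> real (card S) \<le> C2 * (1 / r) ^ n \<and> W \<subseteq> (\<Union>s\<in>S. ball s r)"
    using assms(2) unfolding covered_polynomially_def by auto
  have "\<exists>S. finite S \<and> real (card S) \<le> (C1 + C2) * (1 / r) ^ n \<and> V \<union> W \<subseteq> (\<Union>s\<in>S. ball s r)"
    if r: "0 < r" "r < 1" for r
  proof -
    obtain S1 where S1: "finite S1" "real (card S1) \<le> C1 * (1 / r) ^ n" "V \<subseteq> (\<Union>s\<in>S1. ball s r)"
      using C1(2)[OF r] by auto
    obtain S2 where S2: "finite S2" "real (card S2) \<le> C2 * (1 / r) ^ n" "W \<subseteq> (\<Union>s\<in>S2. ball s r)"
      using C2(2)[OF r] by auto
    have "real (card (S1 \<union> S2)) \<le> real (card S1) + real (card S2)"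
      using card_Un_le[of S1 S2] by linarith
    also have "\<dots> \<le> (C1 + C2) * (1 / r) ^ n"
      using S1(2) S2(2) by (simp add: algebra_simps)
    finally show ?thesis
      using S1 S2 by (intro exI[of _ "S1 \<union> S2"]) auto
  qed
  then show ?thesis
    unfolding covered_polynomially_def using C1(1) C2(1) by (intro exI[of _ "C1 + C2"]) auto
qed

lemma covered_polynomially_UN:
  assumes "finite I" "\<And>i. i \<in> I \<Longrightarrow> covered_polynomially n (V i)"
  shows "covered_polynomially n (\<Union>i\<in>I. V i)"
  using assms
proof (induction I rule: finite_induct)
  case empty
  show ?case
    unfolding covered_polynomially_def by (intro exI[of _ 0]) (auto intro!: exI[of _ "{}"])
next
  case (insert i I)
  then show ?case by (simp add: covered_polynomially_Un)
qed

text \<open>Cut the ball into the cells of a grid of mesh \<open>r / ((L + 1) * DIM('e))\<close>, so that a cell has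
  diameter at most \<open>r / (L + 1)\<close> and its image has diameter less than \<open>r\<close>. One point from each cell that
  meets the ball suffices, and such cells are labelled by integer vectors with entries in a range of
  length proportional to \<open>1 / r\<close>.\<close>

lemma covered_polynomially_lipschitz_image:
  fixes f :: "'e::euclidean_space \<Rightarrow> 'x::metric_space"
  assumes f: "L-lipschitz_on (cball a R) f"
  shows "covered_polynomially DIM('e) (f ` cball a R)"
proof (cases "R < 0")
  case True
  then show ?thesis
    unfolding covered_polynomially_def by (intro exI[of _ 0]) (auto intro!: exI[of _ "{}"])
next
  case R: False
  define d where "d = real DIM('e)"
  have d: "d \<ge> 1" unfolding d_def by (simp add: DIM_positive Suc_le_eq)
  have L: "L \<ge> 0" using f by (rule lipschitz_on_nonneg)
  define h where "h = 1 / ((L + 1) * d)"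
  have h: "h > 0" using L d unfolding h_def by simp
  define b where "b = norm a + R"
  have b: "b \<ge> 0" using R unfolding b_def by simp
  define C where "C = (2 * (b / h + 1) + 1) ^ DIM('e)"
  have C: "C \<ge> 0" using b h unfolding C_def by simp
  have "\<exists>S. finite S \<and> real (card S) \<le> C * (1 / r) ^ DIM('e) \<and> f ` cball a R \<subseteq> (\<Union>s\<in>S. ball s r)"
    if r: "0 < r" "r < 1" for r
  proof -
    define cell where "cell y = (\<lambda>i\<in>Basis. \<lfloor>(y \<bullet> i) / (h * r)\<rfloor>)" for y :: 'e
    define N where "N = \<lceil>b / (h * r)\<rceil>"
    have "0 \<le> b / (h * r)" using b h r by simp
    then have N0: "N \<ge> 0" unfolding N_def by linarith
    have cell: "cell ` cball a R \<subseteq> Basis \<rightarrow>\<^sub>E {-N..N}"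
    proof (clarify, rule PiE_I)
      fix y i assume y: "y \<in> cball a R" and i: "i \<in> (Basis :: 'e set)"
      have "norm y \<le> b"
        using y norm_triangle_ineq[of a "y - a"] by (simp add: b_def dist_norm norm_minus_commute)
      then have "\<bar>y \<bullet> i\<bar> \<le> b" using Basis_le_norm[OF i, of y] by linarith
      then have "\<bar>(y \<bullet> i) / (h * r)\<bar> \<le> b / (h * r)"
        using h r by (simp add: divide_right_mono)
      also have "\<dots> \<le> N" unfolding N_def by simp
      finally have "\<bar>(y \<bullet> i) / (h * r)\<bar> \<le> N" .
      then have "- of_int N \<le> (y \<bullet> i) / (h * r)" "(y \<bullet> i) / (h * r) \<le> of_int N" by linarith+
      then have "- N \<le> \<lfloor>(y \<bullet> i) / (h * r)\<rfloor>" "\<lfloor>(y \<bullet> i) / (h * r)\<rfloor> \<le> N"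
        by (simp add: le_floor_iff, linarith)
      then show "cell y i \<in> {-N..N}"
        using i by (simp add: cell_def)
    qed (simp add: cell_def)
    have finP: "finite (Basis \<rightarrow>\<^sub>E {-N..N} :: ('e \<Rightarrow> int) set)"
      by (simp add: finite_PiE)
    have "\<exists>T\<subseteq>cball a R. inj_on cell T \<and> cell ` cball a R = cell ` T"
      by (simp flip: subset_image_inj)
    then obtain T where T: "T \<subseteq> cball a R" "inj_on cell T" "cell ` cball a R = cell ` T"
      by blast
    have finT: "finite T"
      using T cell finP by (metis finite_imageD finite_subset)
    have "card T = card (cell ` cball a R)" using T by (simp add: card_image)
    also have "\<dots> \<le> card (Basis \<rightarrow>\<^sub>E {-N..N} :: ('e \<Rightarrow> int) set)"
      using cell finP by (rule card_mono[rotated])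
    also have "\<dots> = nat (2 * N + 1) ^ DIM('e)"
      using N0 by (simp add: card_PiE)
    finally have "real (card T) \<le> real (nat (2 * N + 1) ^ DIM('e))" by linarith
    also have "\<dots> = (2 * of_int N + 1) ^ DIM('e)" using N0 by simp
    also have "\<dots> \<le> ((2 * (b / h + 1) + 1) * (1 / r)) ^ DIM('e)"
    proof (rule power_mono)
      have "of_int N \<le> b / (h * r) + 1" unfolding N_def by linarith
      then have "2 * of_int N + 1 \<le> 2 * (b / (h * r)) + 3" by linarith
      also have "\<dots> \<le> 2 * (b / (h * r)) + 3 * (1 / r)" using r by (simp add: le_divide_eq)
      also have "\<dots> = (2 * (b / h + 1) + 1) * (1 / r)" using h r by (simp add: field_simps)
      finally show "2 * of_int N + 1 \<le> (2 * (b / h + 1) + 1) * (1 / r)" .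
    qed (use N0 in simp)
    also have "\<dots> = C * (1 / r) ^ DIM('e)" unfolding C_def by (simp only: power_mult_distrib)
    finally have cardT: "real (card T) \<le> C * (1 / r) ^ DIM('e)" .
    have "f y \<in> (\<Union>s\<in>f ` T. ball s r)" if y: "y \<in> cball a R" for y
    proof -
      obtain t where t: "t \<in> T" "cell t = cell y" using T(3) y by (metis imageE imageI)
      have "norm (t - y) \<le> (\<Sum>i\<in>Basis. \<bar>(t - y) \<bullet> i\<bar>)" by (rule norm_le_l1)
      also have "\<dots> \<le> (\<Sum>i\<in>(Basis::'e set). h * r)"
      proof (rule sum_mono)
        fix i :: 'e assume i: "i \<in> Basis"
        have "\<lfloor>(t \<bullet> i) / (h * r)\<rfloor> = \<lfloor>(y \<bullet> i) / (h * r)\<rfloor>"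
          using fun_cong[OF t(2), of i] i by (simp add: cell_def)
        then have "\<bar>(t \<bullet> i) / (h * r) - (y \<bullet> i) / (h * r)\<bar> \<le> 1" by linarith
        then have "\<bar>(t \<bullet> i - y \<bullet> i) / (h * r)\<bar> \<le> 1" by (simp add: diff_divide_distrib)
        then show "\<bar>(t - y) \<bullet> i\<bar> \<le> h * r"
          using h r by (simp add: inner_diff_left divide_le_eq)
      qed
      also have "\<dots> = d * (h * r)" by (simp add: d_def)
      also have "\<dots> = r / (L + 1)" using d L unfolding h_def by simp
      finally have "dist t y \<le> r / (L + 1)" by (simp add: dist_norm)
      have "dist (f t) (f y) \<le> L * dist t y"
        using f T(1) t(1) y by (meson lipschitz_onD subsetD)
      also have "\<dots> \<le> L * (r / (L + 1))"
        using \<open>dist t y \<le> r / (L + 1)\<close> L by (rule mult_left_mono)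
      also have "\<dots> < r" using L r by (simp add: field_simps)
      finally show ?thesis using t(1) by auto
    qed
    moreover have "card (f ` T) \<le> card T" using finT by (rule card_image_le)
    ultimately show ?thesis
      using finT cardT by (intro exI[of _ "f ` T"]) auto
  qed
  then show ?thesis
    unfolding covered_polynomially_def using C by blast
qed

lemma smooth_on_imp_C1:
  assumes "smooth_on S f"
  shows "x \<in> S \<Longrightarrow> f differentiable (at x)"
    and "continuous_on S (\<lambda>x. frechet_derivative f (at x) v)"
proof -
  have "Ck_on (Suc 0) S f" using assms unfolding smooth_on_def by blast
  then show "x \<in> S \<Longrightarrow> f differentiable (at x)"
    and "continuous_on S (\<lambda>x. frechet_derivative f (at x) v)" by auto
qed

locale atlas_metric =
  fixes A :: "('x::metric_space, 'e::euclidean_space) chart set"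
    and g :: "('x, 'e) chart \<Rightarrow> 'e \<Rightarrow> 'e \<Rightarrow> 'e \<Rightarrow> real"
  assumes atlas: "smooth_atlas A" and metric: "riemannian_metric A g"
begin

lemma chart_inverse:
  assumes "c \<in> A" "y \<in> snd c ` fst c"
  shows "inv_into (fst c) (snd c) y \<in> fst c" "snd c (inv_into (fst c) (snd c) y) = y"
  using assms by (auto intro: inv_into_into f_inv_into_f)

lemma chart_homeomorphism:
  assumes "c \<in> A"
  shows "open (fst c)" "open (snd c ` fst c)"
    "homeomorphism (fst c) (snd c ` fst c) (snd c) (inv_into (fst c) (snd c))"
  using assms atlas unfolding smooth_atlas_def is_chart_def by (auto simp: case_prod_beta)

lemma quadratic_form_nonneg:
  assumes "c \<in> A" "y \<in> snd c ` fst c"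
  shows "0 \<le> g c y v v"
proof (cases "v = 0")
  case True
  have "bilinear (g c y)" using metric assms unfolding riemannian_metric_def by blast
  then show ?thesis using True by (simp add: bilinear_lzero)
next
  case False
  then show ?thesis using metric assms unfolding riemannian_metric_def by (meson less_imp_le)
qed

lemma speed_nonneg: "0 \<le> speed A g \<gamma> t"
proof -
  define c where "c = (SOME c. c \<in> A \<and> \<gamma> t \<in> fst c)"
  have "\<exists>c. c \<in> A \<and> \<gamma> t \<in> fst c" using atlas unfolding smooth_atlas_def by blast
  then have "c \<in> A \<and> \<gamma> t \<in> fst c" unfolding c_def by (rule someI_ex)
  then show ?thesis
    unfolding speed_def Let_def c_def[symmetric] by (auto intro!: quadratic_form_nonneg)
qed

text \<open>The infimum of lengths that defines the distance is bounded below, hence is at most the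
  length of any particular curve; nonintegrable speeds have integral \<open>0\<close>.\<close>

lemma curve_length_nonneg: "0 \<le> curve_length A g \<gamma>"
  unfolding curve_length_def
  by (cases "speed A g \<gamma> integrable_on {0..1}")
     (auto intro: integral_nonneg speed_nonneg simp: not_integrable_integral)

text \<open>The coefficients of the metric in the standard basis are continuous, so bounded on
  \<open>K\<close>; expanding \<open>v\<close> in this basis turns their bounds into one for the quadratic form.\<close>

lemma metric_bounded_on_compact:
  assumes c: "c \<in> A" and K: "compact K" "K \<subseteq> snd c ` fst c"
  obtains m where "m \<ge> 0" "\<And>y v. y \<in> K \<Longrightarrow> g c y v v \<le> (m * norm v)\<^sup>2"
proof -
  have "\<exists>B. \<forall>y\<in>K. \<bar>g c y i j\<bar> \<le> B" for i j
  proof -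
    have "smooth_on (snd c ` fst c) (\<lambda>y. g c y i j)"
      using metric c unfolding riemannian_metric_def by blast
    then have "Ck_on 0 (snd c ` fst c) (\<lambda>y. g c y i j)"
      unfolding smooth_on_def by blast
    then have "continuous_on K (\<lambda>y. g c y i j)"
      using K(2) continuous_on_subset by auto
    then have "bounded ((\<lambda>y. g c y i j) ` K)"
      using K(1) compact_continuous_image compact_imp_bounded by blast
    then show ?thesis unfolding bounded_iff by auto
  qed
  then obtain B where B: "\<And>i j y. y \<in> K \<Longrightarrow> \<bar>g c y i j\<bar> \<le> B i j" by metis
  define b where "b = (\<Sum>(i, j)\<in>Basis \<times> Basis. \<bar>B i j\<bar>)"
  have b: "b \<ge> 0" unfolding b_def by (auto intro: sum_nonneg)
  have "g c y v v \<le> (sqrt b * norm v)\<^sup>2" if y: "y \<in> K" for y v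
  proof -
    have "y \<in> snd c ` fst c" using y K(2) by blast
    then have bil: "bilinear (g c y)" using metric c unfolding riemannian_metric_def by blast
    have "g c y v v = g c y (\<Sum>i\<in>Basis. (v \<bullet> i) *\<^sub>R i) (\<Sum>i\<in>Basis. (v \<bullet> i) *\<^sub>R i)"
      by (simp only: euclidean_representation)
    also have "\<dots> = (\<Sum>(i, j)\<in>Basis \<times> Basis. g c y ((v \<bullet> i) *\<^sub>R i) ((v \<bullet> j) *\<^sub>R j))"
      using bil by (rule bilinear_sum)
    also have "\<dots> = (\<Sum>(i, j)\<in>Basis \<times> Basis. (v \<bullet> i) * (v \<bullet> j) * g c y i j)"
      by (simp add: bilinear_lmul[OF bil] bilinear_rmul[OF bil] mult.left_commute mult.assoc)
    also have "\<dots> \<le> (\<Sum>(i, j)\<in>Basis \<times> Basis. (norm v)\<^sup>2 * \<bar>B i j\<bar>)"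
    proof (rule sum_mono, clarify)
      fix i j :: 'e assume ij: "i \<in> Basis" "j \<in> Basis"
      have "(v \<bullet> i) * (v \<bullet> j) * g c y i j \<le> \<bar>v \<bullet> i\<bar> * \<bar>v \<bullet> j\<bar> * \<bar>g c y i j\<bar>"
        by (metis abs_ge_self abs_mult)
      also have "\<dots> \<le> norm v * norm v * \<bar>B i j\<bar>"
        using Basis_le_norm[OF ij(1), of v] Basis_le_norm[OF ij(2), of v] B[OF y, of i j]
        by (intro mult_mono) auto
      finally show "(v \<bullet> i) * (v \<bullet> j) * g c y i j \<le> (norm v)\<^sup>2 * \<bar>B i j\<bar>"
        by (simp add: power2_eq_square)
    qed
    also have "\<dots> = (norm v)\<^sup>2 * b" unfolding b_def sum_distrib_left by (simp add: case_prod_beta)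
    also have "\<dots> = (sqrt b * norm v)\<^sup>2" using b by (simp add: power_mult_distrib)
    finally show ?thesis .
  qed
  then show ?thesis using that[of "sqrt b"] b by simp
qed

text \<open>The curve \<open>\<gamma>\<close> follows a straight coordinate segment in the chart \<open>c\<close>. In any other chart \<open>c'\<close>
  it reads \<open>transition c c' \<circ> s\<close>, which holds for all parameters and reduces its regularity to the smoothness
  of transition maps.\<close>

context
  fixes c and y y' :: 'e and s :: "real \<Rightarrow> 'e" and \<gamma> :: "real \<Rightarrow> 'x"
  assumes c: "c \<in> A" and seg: "closed_segment y y' \<subseteq> snd c ` fst c"
  defines "s \<equiv> \<lambda>t. y + t *\<^sub>R (y' - y)"
  defines "\<gamma> \<equiv> inv_into (fst c) (snd c) \<circ> s"
begin

lemma segment_in_chart: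
  assumes "t \<in> {0..1}"
  shows "s t \<in> closed_segment y y'" "\<gamma> t \<in> fst c" "snd c (\<gamma> t) = s t"
proof -
  have "s t = (1 - t) *\<^sub>R y + t *\<^sub>R y'" unfolding s_def by (simp add: algebra_simps)
  then show *: "s t \<in> closed_segment y y'" using assms by (auto simp: in_segment)
  show "\<gamma> t \<in> fst c" "snd c (\<gamma> t) = s t"
    using chart_inverse[OF c, of "s t"] * seg unfolding \<gamma>_def by auto
qed

lemma segment_derivative:
  assumes c': "c' \<in> A" and t: "t \<in> {0..1}" "\<gamma> t \<in> fst c'"
  shows "((snd c' \<circ> \<gamma>) has_vector_derivative
      frechet_derivative (transition c c') (at (s t)) (y' - y)) (at t within I)"
proof -
  have "s t \<in> snd c ` (fst c \<inter> fst c')"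
    using segment_in_chart[OF t(1)] t(2) by (metis IntI image_eqI)
  moreover have "smooth_on (snd c ` (fst c \<inter> fst c')) (transition c c')"
    using atlas c c' unfolding smooth_atlas_def by blast
  ultimately have "transition c c' differentiable (at (s t))"
    by (metis smooth_on_imp_C1(1))
  then have "(transition c c' has_derivative frechet_derivative (transition c c') (at (s t))) (at (s t))"
    by (simp add: frechet_derivative_works)
  moreover have "(s has_vector_derivative (y' - y)) (at t)"
    unfolding s_def by (auto intro!: derivative_eq_intros)
  ultimately have "((transition c c' \<circ> s) has_vector_derivative
      frechet_derivative (transition c c') (at (s t)) (y' - y)) (at t)"
    using vector_derivative_diff_chain_within[of s "y' - y" t UNIV "transition c c'"
        "frechet_derivative (transition c c') (at (s t))"]
    by (auto intro: has_derivative_at_withinI)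
  moreover have "transition c c' \<circ> s = snd c' \<circ> \<gamma>"
    unfolding transition_def \<gamma>_def by (simp add: comp_assoc)
  ultimately show ?thesis by (simp add: has_vector_derivative_at_within)
qed

lemma segment_curve: "\<gamma> \<in> curves_between A (inv_into (fst c) (snd c) y) (inv_into (fst c) (snd c) y')"
proof -
  have conts: "continuous_on I s" for I unfolding s_def by (intro continuous_intros)
  have "C1_curve_on A {a..b} \<gamma>" if ab: "0 \<le> a" "b \<le> 1" for a b
    unfolding C1_curve_on_def
  proof (intro conjI)
    have "s ` {a..b} \<subseteq> snd c ` fst c"
      using segment_in_chart(1) seg ab by fastforce
    then show "continuous_on {a..b} \<gamma>"
      using chart_homeomorphism(3)[OF c] unfolding \<gamma>_def
      by (intro continuous_on_compose conts) (meson continuous_on_subset homeomorphism_cont2)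
  next
    show "\<forall>(U, \<phi>)\<in>A. \<exists>D. continuous_on ({a..b} \<inter> \<gamma> -` U) D \<and>
        (\<forall>t\<in>{a..b} \<inter> \<gamma> -` U. ((\<phi> \<circ> \<gamma>) has_vector_derivative D t) (at t within {a..b}))"
    proof clarify
      fix U \<phi> assume U: "(U, \<phi>) \<in> A"
      define D where "D t = frechet_derivative (transition c (U, \<phi>)) (at (s t)) (y' - y)" for t
      have "smooth_on (snd c ` (fst c \<inter> U)) (transition c (U, \<phi>))"
        using atlas c U unfolding smooth_atlas_def by fastforce
      then have "continuous_on (snd c ` (fst c \<inter> U))
          (\<lambda>x. frechet_derivative (transition c (U, \<phi>)) (at x) (y' - y))"
        by (rule smooth_on_imp_C1(2))
      moreover have "s ` ({a..b} \<inter> \<gamma> -` U) \<subseteq> snd c ` (fst c \<inter> U)"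
      proof clarify
        fix t assume "t \<in> {a..b}" "\<gamma> t \<in> U"
        then show "s t \<in> snd c ` (fst c \<inter> U)"
          using segment_in_chart[of t] ab by (metis IntI atLeastAtMost_iff image_eqI order_trans)
      qed
      ultimately have "continuous_on ({a..b} \<inter> \<gamma> -` U) D"
        unfolding D_def by (rule continuous_on_compose2[OF _ conts])
      moreover have "\<forall>t\<in>{a..b} \<inter> \<gamma> -` U. ((\<phi> \<circ> \<gamma>) has_vector_derivative D t) (at t within {a..b})"
        using segment_derivative[OF U] ab unfolding D_def by auto
      ultimately show "\<exists>D. continuous_on ({a..b} \<inter> \<gamma> -` U) D \<and>
          (\<forall>t\<in>{a..b} \<inter> \<gamma> -` U. ((\<phi> \<circ> \<gamma>) has_vector_derivative D t) (at t within {a..b}))"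
        by blast
    qed
  qed
  then have "piecewise_C1_curve A \<gamma>"
    unfolding piecewise_C1_curve_def by (intro exI[of _ "{}"]) auto
  then show ?thesis
    unfolding curves_between_def by (simp add: \<gamma>_def s_def)
qed

text \<open>The transformation law of the metric makes the speed independent of the chart in which it
  is measured, and the chart \<open>c\<close> sees the constant velocity \<open>y' - y\<close>.\<close>

lemma segment_speed:
  assumes t: "t \<in> {0..1}"
  shows "speed A g \<gamma> t = sqrt (g c (s t) (y' - y) (y' - y))"
proof -
  define c' where "c' = (SOME c. c \<in> A \<and> \<gamma> t \<in> fst c)"
  have "\<exists>c. c \<in> A \<and> \<gamma> t \<in> fst c" using atlas unfolding smooth_atlas_def by blast
  then have c': "c' \<in> A" "\<gamma> t \<in> fst c'" unfolding c'_def by (metis (mono_tags, lifting) someI_ex)+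
  have "vector_derivative (snd c' \<circ> \<gamma>) (at t within {0..1}) =
      frechet_derivative (transition c c') (at (s t)) (y' - y)"
    using vector_derivative_within_cbox[of 0 1 t] segment_derivative[OF c'(1) t c'(2), of "{0..1}"] t
    by (simp add: cbox_interval)
  moreover have "g c (snd c (\<gamma> t)) v w =
      (let D = frechet_derivative (transition c c') (at (snd c (\<gamma> t))) in g c' (snd c' (\<gamma> t)) (D v) (D w))"
    for v w
    using metric c c' segment_in_chart(2)[OF t] unfolding riemannian_metric_def by blast
  ultimately show ?thesis
    unfolding speed_def c'_def[symmetric] Let_def using segment_in_chart(3)[OF t] by simp
qed

end

end

text \<open>The distance of two points is at most the length of the curve over the straight coordinate
  segment that joins them, and this length is at most a multiple of the Euclidean distance of the coordinates.\<close>

lemma chart_inverse_lipschitz: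
  assumes X: "compact_riemannian_manifold A g" and c: "c \<in> A"
    and K: "compact K" "convex K" "K \<subseteq> snd c ` fst c"
  obtains m where "m-lipschitz_on K (inv_into (fst c) (snd c))"
proof -
  interpret atlas_metric A g
    using X unfolding compact_riemannian_manifold_def by unfold_locales auto
  obtain m where m: "m \<ge> 0" "\<And>y v. y \<in> K \<Longrightarrow> g c y v v \<le> (m * norm v)\<^sup>2"
    using metric_bounded_on_compact[OF c K(1,3)] by blast
  have "dist (inv_into (fst c) (snd c) y) (inv_into (fst c) (snd c) y') \<le> m * dist y y'"
    if y: "y \<in> K" "y' \<in> K" for y y'
  proof -
    define s where "s = (\<lambda>t. y + t *\<^sub>R (y' - y))"
    define \<gamma> where "\<gamma> = inv_into (fst c) (snd c) \<circ> s"
    let ?x = "inv_into (fst c) (snd c) y" and ?x' = "inv_into (fst c) (snd c) y'"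
    have "closed_segment y y' \<subseteq> K" using K(2) y by (simp add: closed_segment_subset)
    then have seg: "closed_segment y y' \<subseteq> snd c ` fst c" using K(3) by simp
    have curve: "\<gamma> \<in> curves_between A ?x ?x'"
      using segment_curve[OF c seg] unfolding \<gamma>_def s_def .
    have speed: "speed A g \<gamma> t \<le> m * dist y y'" if t: "t \<in> {0..1}" for t
    proof -
      have "s t \<in> K"
        using segment_in_chart(1)[OF c seg t] \<open>closed_segment y y' \<subseteq> K\<close> unfolding s_def by blast
      have "speed A g \<gamma> t = sqrt (g c (s t) (y' - y) (y' - y))"
        using segment_speed[OF c seg t] unfolding \<gamma>_def s_def .
      also have "\<dots> \<le> sqrt ((m * norm (y' - y))\<^sup>2)"
        using m(2)[OF \<open>s t \<in> K\<close>] by (rule real_sqrt_le_mono)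
      also have "\<dots> = m * dist y y'"
        using m(1) by (simp add: dist_norm norm_minus_commute)
      finally show ?thesis .
    qed
    have "dist ?x ?x' = (INF \<gamma>\<in>curves_between A ?x ?x'. curve_length A g \<gamma>)"
      using X curve unfolding compact_riemannian_manifold_def by blast
    also have "\<dots> \<le> curve_length A g \<gamma>"
      using curve by (intro cINF_lower bdd_belowI[of _ 0]) (auto simp: curve_length_nonneg)
    also have "\<dots> \<le> m * dist y y'"
    proof (cases "speed A g \<gamma> integrable_on {0..1}")
      case True
      then have "integral {0..1} (speed A g \<gamma>) \<le> integral {0..1::real} (\<lambda>t. m * dist y y')"
        using speed by (intro integral_le) auto
      then show ?thesis unfolding curve_length_def by simp
    next
      case False
      then show ?thesis
        unfolding curve_length_def using m(1) by (simp add: not_integrable_integral)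
    qed
    finally show ?thesis .
  qed
  then show ?thesis using that m(1) lipschitz_onI by blast
qed

lemma manifold_covered_polynomially:
  fixes A :: "('x::metric_space, 'e::euclidean_space) chart set"
  assumes X: "compact_riemannian_manifold A g"
  shows "covered_polynomially DIM('e) (UNIV :: 'x set)"
proof -
  interpret atlas_metric A g
    using X unfolding compact_riemannian_manifold_def by unfold_locales auto
  have "\<exists>V. open V \<and> x \<in> V \<and> covered_polynomially DIM('e) V" for x :: 'x
  proof -
    obtain c where c: "c \<in> A" "x \<in> fst c" using atlas unfolding smooth_atlas_def by blast
    note hom = chart_homeomorphism[OF c(1)]
    let ?f = "inv_into (fst c) (snd c)"
    obtain R where R: "R > 0" "cball (snd c x) R \<subseteq> snd c ` fst c"
      using hom(2) c(2) by (meson imageI open_contains_cball)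
    obtain m where m: "m-lipschitz_on (cball (snd c x) R) ?f"
      using chart_inverse_lipschitz[OF X c(1) compact_cball convex_cball R(2)] .
    have "openin (top_of_set (fst c)) (fst c \<inter> snd c -` ball (snd c x) R)"
      using hom(3) by (meson continuous_openin_preimage_gen homeomorphism_cont1 open_ball)
    then have "open (fst c \<inter> snd c -` ball (snd c x) R)"
      using hom(1) openin_open_trans by blast
    moreover have "fst c \<inter> snd c -` ball (snd c x) R \<subseteq> ?f ` cball (snd c x) R"
    proof
      fix u assume u: "u \<in> fst c \<inter> snd c -` ball (snd c x) R"
      then have "?f (snd c u) = u" using hom(3) by (meson Int_iff homeomorphism_apply1)
      then show "u \<in> ?f ` cball (snd c x) R" using u by (intro image_eqI[of _ _ "snd c u"]) auto
    qed
    ultimately show ?thesis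
      using c(2) R(1) covered_polynomially_subset[OF covered_polynomially_lipschitz_image[OF m]]
      by (intro exI[of _ "fst c \<inter> snd c -` ball (snd c x) R"]) auto
  qed
  then obtain V where V: "\<And>x. open (V x)" "\<And>x. x \<in> V x" "\<And>x :: 'x. covered_polynomially DIM('e) (V x)"
    by metis
  have "compact (UNIV :: 'x set)" using X unfolding compact_riemannian_manifold_def by blast
  then obtain I where I: "finite I" "UNIV \<subseteq> (\<Union>x\<in>I. V x)"
    by (rule compactE_image[where C = UNIV and f = V]) (use V(1,2) in auto)
  show ?thesis
    using covered_polynomially_UN[OF I(1) V(3)] I(2) by (rule covered_polynomially_subset)
qed

section \<open>Balls in a compact metric space\<close>

text \<open>On a metric space that need not be second countable, an open set of the product may fail to
  belong to the product of the Borel sigma-algebras. A countable dense set, supplied by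
  compactness, expresses \<open>dist u v < r\<close> by countably many conditions on \<open>u\<close> and \<open>v\<close> separately.\<close>

lemma borel_measurable_dist_compact:
  fixes f h :: "'z \<Rightarrow> 'x::metric_space"
  assumes X: "compact (UNIV :: 'x set)" and f: "f \<in> borel_measurable M" and h: "h \<in> borel_measurable M"
  shows "(\<lambda>z. dist (f z) (h z)) \<in> borel_measurable M"
proof -
  have "\<exists>k. finite k \<and> (UNIV :: 'x set) \<subseteq> (\<Union>x\<in>k. ball x (1 / Suc n))" for n
    using X unfolding compact_eq_totally_bounded by auto
  then obtain Q where Q: "\<And>n. finite (Q n)" "\<And>n. (UNIV :: 'x set) \<subseteq> (\<Union>x\<in>Q n. ball x (1 / Suc n))"
    by metis
  have meas: "{z\<in>space M. dist (f z) a < s} \<in> sets M" "{z\<in>space M. dist a (h z) < s} \<in> sets M" for a s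
  proof -
    have "{z\<in>space M. dist (f z) a < s} = f -` ball a s \<inter> space M"
      "{z\<in>space M. dist a (h z) < s} = h -` ball a s \<inter> space M"
      by (auto simp: dist_commute)
    then show "{z\<in>space M. dist (f z) a < s} \<in> sets M" "{z\<in>space M. dist a (h z) < s} \<in> sets M"
      using f h by (auto intro: measurable_sets)
  qed
  have "{z\<in>space M. dist (f z) (h z) < r} \<in> sets M" for r
  proof -
    have "dist u v < r \<longleftrightarrow> (\<exists>n. \<exists>a\<in>Q n. dist u a < 1 / Suc n \<and> dist a v < r - 1 / Suc n)" for u v
    proof
      assume "dist u v < r"
      then obtain n where n: "1 / Suc n < (r - dist u v) / 2"
        using nat_approx_posE[of "(r - dist u v) / 2"] by auto
      have "u \<in> (\<Union>x\<in>Q n. ball x (1 / Suc n))" using Q(2) by blast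
      then obtain a where a: "a \<in> Q n" "u \<in> ball a (1 / Suc n)" by (rule UN_E)
      have "dist a v \<le> dist a u + dist u v" by (rule dist_triangle)
      then have "dist u a < 1 / Suc n \<and> dist a v < r - 1 / Suc n"
        using a n \<open>dist u v < r\<close> unfolding mem_ball by (simp add: dist_commute)
      then show "\<exists>n. \<exists>a\<in>Q n. dist u a < 1 / Suc n \<and> dist a v < r - 1 / Suc n"
        using a(1) by blast
    next
      assume "\<exists>n. \<exists>a\<in>Q n. dist u a < 1 / Suc n \<and> dist a v < r - 1 / Suc n"
      then obtain n a where "dist u a < 1 / Suc n" "dist a v < r - 1 / Suc n" by blast
      then show "dist u v < r" using dist_triangle[of u v a] by linarith
    qed
    then have "{z\<in>space M. dist (f z) (h z) < r} = (\<Union>n. \<Union>a\<in>Q n.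
        {z\<in>space M. dist (f z) a < 1 / Suc n} \<inter> {z\<in>space M. dist a (h z) < r - 1 / Suc n})"
      by auto
    also have "\<dots> \<in> sets M"
      using meas Q(1) by (intro sets.countable_UN sets.finite_UN) auto
    finally show ?thesis .
  qed
  then show ?thesis by (intro borel_measurableI_less) auto
qed

text \<open>Open balls vary lower semicontinuously: a slightly smaller ball around \<open>x\<close> has nearly the same
  measure and is contained in the ball of radius \<open>r\<close> around every nearby point.\<close>

lemma borel_measurable_measure_ball:
  fixes \<mu> :: "'x::metric_space measure"
  assumes "finite_measure \<mu>" "sets \<mu> = sets borel"
  shows "(\<lambda>x. measure \<mu> (ball x r)) \<in> borel_measurable borel"
proof (intro borel_measurableI_greater)
  fix a
  interpret finite_measure \<mu> by fact
  have "open {x. a < measure \<mu> (ball x r)}"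
    unfolding open_contains_ball
  proof clarify
    fix x assume x: "a < measure \<mu> (ball x r)"
    have "(\<lambda>n. measure \<mu> (ball x (r - 1 / Suc n))) \<longlonglongrightarrow> measure \<mu> (\<Union>n. ball x (r - 1 / Suc n))"
    proof (rule finite_Lim_measure_incseq)
      show "range (\<lambda>n. ball x (r - 1 / Suc n)) \<subseteq> sets \<mu>"
        unfolding assms(2) by (intro image_subsetI) (rule borel_open, rule open_ball)
      show "incseq (\<lambda>n. ball x (r - 1 / Suc n))"
      proof (rule incseq_SucI, rule subset_ball)
        show "r - 1 / Suc n \<le> r - 1 / Suc (Suc n)" for n by (simp add: frac_le)
      qed
    qed
    moreover have "(\<Union>n. ball x (r - 1 / Suc n)) = ball x r"
    proof (intro equalityI subsetI)
      fix v assume "v \<in> ball x r"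
      then obtain n where "1 / Suc n < r - dist x v"
        using nat_approx_posE[of "r - dist x v"] by auto
      then have "v \<in> ball x (r - 1 / Suc n)" unfolding mem_ball by linarith
      then show "v \<in> (\<Union>n. ball x (r - 1 / Suc n))" by (rule UN_I[OF UNIV_I])
    next
      fix v assume "v \<in> (\<Union>n. ball x (r - 1 / Suc n))"
      then obtain n where "v \<in> ball x (r - 1 / Suc n)" by (rule UN_E)
      moreover have "0 < 1 / real (Suc n)" by simp
      ultimately show "v \<in> ball x r" unfolding mem_ball by linarith
    qed
    ultimately have "eventually (\<lambda>n. a < measure \<mu> (ball x (r - 1 / Suc n))) sequentially"
      using x by (simp add: order_tendstoD(1))
    then obtain n where n: "a < measure \<mu> (ball x (r - 1 / Suc n))"
      by (auto simp: eventually_sequentially)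
    have "a < measure \<mu> (ball x' r)" if "x' \<in> ball x (1 / Suc n)" for x'
    proof -
      have "ball x (r - 1 / Suc n) \<subseteq> ball x' r"
      proof
        fix v assume "v \<in> ball x (r - 1 / Suc n)"
        then show "v \<in> ball x' r"
          using that dist_triangle[of x' v x] by (simp add: dist_commute)
      qed
      then have "measure \<mu> (ball x (r - 1 / Suc n)) \<le> measure \<mu> (ball x' r)"
        using assms(2) by (intro finite_measure_mono) auto
      then show ?thesis using n by linarith
    qed
    then show "\<exists>e>0. ball x e \<subseteq> {x. a < measure \<mu> (ball x r)}"
      by (intro exI[of _ "1 / Suc n"]) auto
  qed
  then show "{x \<in> space borel. a < measure \<mu> (ball x r)} \<in> sets borel" by simp
qed

section \<open>Averaging over centres and late returns\<close>

lemma distr_funpow: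
  assumes "G \<in> measurable M M" "distr M M G = M"
  shows "distr M M (G ^^ k) = M"
proof (induction k)
  case 0
  show ?case by (simp add: distr_id)
next
  case (Suc k)
  have "G ^^ k \<in> measurable M M" using assms(1) by (rule measurable_compose_n)
  then have "distr M M (G \<circ> G ^^ k) = distr (distr M M (G ^^ k)) M G"
    using assms(1) by (simp add: distr_distr)
  then show ?case unfolding funpow.simps using Suc assms(2) by (simp only:)
qed

text \<open>This is Kac's inequality: the left-hand side is the integral over \<open>B\<close> of the first return time,
  written as the sum of its tail probabilities. By invariance, the \<open>n\<close>-th term is the probability that, among
  the times \<open>0, \<dots>, N - 1\<close>, the last visit to \<open>B\<close> takes place at time \<open>N - 1 - n\<close>; these events are disjoint.\<close>

lemma suminf_emeasure_no_return_le_1: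
  assumes "prob_space M" and G[measurable]: "G \<in> measurable M M" and "distr M M G = M"
    and B[measurable]: "B \<in> sets M"
  shows "(\<Sum>n. emeasure M {z\<in>B. \<forall>j\<in>{1..n}. (G ^^ j) z \<notin> B}) \<le> 1"
proof (rule suminf_le_const)
  interpret prob_space M by fact
  define A where "A n = {z\<in>B. \<forall>j\<in>{1..n}. (G ^^ j) z \<notin> B}" for n :: nat
  have Gk[measurable]: "G ^^ k \<in> measurable M M" for k by (rule measurable_compose_n) fact
  have A_alt: "A n = {z\<in>space M. z \<in> B \<and> (\<forall>j\<in>{1..n}. (G ^^ j) z \<notin> B)}" for n
    using sets.sets_into_space[OF B] unfolding A_def by auto
  have A[measurable]: "A n \<in> sets M" for n unfolding A_alt by measurable
  fix N
  define C where "C n = (G ^^ (N - 1 - n)) -` A n \<inter> space M" for n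
  have C[measurable]: "C n \<in> sets M" for n unfolding C_def by measurable
  have "emeasure M (A n) = emeasure M (C n)" for n
  proof -
    have "emeasure M (A n) = emeasure (distr M M (G ^^ (N - 1 - n))) (A n)"
      using distr_funpow[OF G assms(3)] by simp
    also have "\<dots> = emeasure M (C n)"
      unfolding C_def by (rule emeasure_distr) auto
    finally show ?thesis .
  qed
  moreover have "C n \<inter> C n' = {}" if "n < n'" "n' < N" for n n'
  proof (rule ccontr)
    assume "C n \<inter> C n' \<noteq> {}"
    then obtain z where z: "(G ^^ (N - 1 - n)) z \<in> A n" "(G ^^ (N - 1 - n')) z \<in> A n'"
      unfolding C_def by auto
    have "(G ^^ (N - 1 - n)) z = (G ^^ (n' - n)) ((G ^^ (N - 1 - n')) z)"
      using that by (simp flip: funpow_add[THEN fun_cong, unfolded comp_def])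
    moreover have "n' - n \<in> {1..n'}" using that by auto
    ultimately show False using z unfolding A_def by auto
  qed
  then have "disjoint_family_on C {..<N}"
    unfolding disjoint_family_on_def by (metis Int_commute lessThan_iff linorder_neqE_nat)
  ultimately have "(\<Sum>n<N. emeasure M (A n)) = emeasure M (\<Union>n<N. C n)"
    by (simp add: sum_emeasure image_subset_iff)
  also have "\<dots> \<le> 1" by (rule emeasure_le_1)
  finally show "(\<Sum>n<N. emeasure M {z\<in>B. \<forall>j\<in>{1..n}. (G ^^ j) z \<notin> B}) \<le> 1"
    unfolding A_def .
qed (rule summableI)

text \<open>A measure-preserving map observed through \<open>\<pi>\<close>. For the skew product of a random dynamical
  system, \<open>\<pi>\<close> forgets the random parameter and the observed orbit of \<open>(\<omega>, x)\<close> is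
  \<open>rds_iter \<theta> T k \<omega> x\<close>.\<close>

locale observed_system = prob_space M for M :: "'z measure" +
  fixes F :: "'z \<Rightarrow> 'z" and \<pi> :: "'z \<Rightarrow> 'x::metric_space" and \<mu> :: "'x measure"
  assumes compact_space: "compact (UNIV :: 'x set)"
    and F_measurable[measurable]: "F \<in> measurable M M"
    and F_preserving: "distr M M F = M"
    and sets_\<mu>[measurable_cong]: "sets \<mu> = sets borel"
    and \<pi>_measurable[measurable]: "\<pi> \<in> measurable M \<mu>"
    and distr_\<pi>: "distr M \<mu> \<pi> = \<mu>"
begin

sublocale \<mu>: prob_space \<mu>
  using prob_space_distr[OF \<pi>_measurable] distr_\<pi> by simp

lemma \<pi>_borel[measurable]: "\<pi> \<in> borel_measurable M"
  using \<pi>_measurable measurable_cong_sets[OF refl sets_\<mu>] by blast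

lemma funpow_measurable[measurable]: "F ^^ k \<in> measurable M M"
  by (rule measurable_compose_n) (rule F_measurable)

lemma funpow_preserving: "distr M M (F ^^ k) = M"
  by (rule distr_funpow) (rule F_measurable, rule F_preserving)

lemma dist_measurable[measurable]:
  "f \<in> borel_measurable N \<Longrightarrow> h \<in> borel_measurable N \<Longrightarrow> (\<lambda>z. dist (f z) (h z :: 'x)) \<in> borel_measurable N"
  by (rule borel_measurable_dist_compact[OF compact_space])

lemma measure_ball_measurable[measurable]:
  "(\<lambda>x. measure \<mu> (ball x r)) \<in> borel_measurable borel"
  using \<mu>.finite_measure_axioms sets_\<mu> by (rule borel_measurable_measure_ball)

lemma measure_ball_mono: "ball x r \<subseteq> ball y s \<Longrightarrow> measure \<mu> (ball x r) \<le> measure \<mu> (ball y s)"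
  using sets_\<mu> by (intro \<mu>.finite_measure_mono) auto

text \<open>Insert \<open>1 = \<integral> indicator (ball (\<pi> z) r) y / measure \<mu> (ball (\<pi> z) r) d\<mu>(y)\<close> into the measure
  of \<open>E\<close> and exchange the two integrals. Each point is weighted by its own ball, so that every fixed centre \<open>y\<close> can be treated on its own.\<close>

lemma emeasure_le_by_averaging:
  assumes E[measurable]: "E \<in> sets M"
    and pos: "\<And>z. z \<in> E \<Longrightarrow> 0 < measure \<mu> (ball (\<pi> z) r)"
    and le: "\<And>y. (\<integral>\<^sup>+z. indicator E z * indicator (ball y r) (\<pi> z) *
               ennreal (1 / measure \<mu> (ball (\<pi> z) r)) \<partial>M) \<le> c"
  shows "emeasure M E \<le> c"
proof -
  interpret pair_sigma_finite M \<mu> ..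
  let ?w = "\<lambda>z. ennreal (1 / measure \<mu> (ball (\<pi> z) r))"
  have [measurable]: "{x \<in> space (M \<Otimes>\<^sub>M \<mu>). dist (snd x) (\<pi> (fst x)) < r} \<in> sets (M \<Otimes>\<^sub>M \<mu>)"
    by measurable
  have "{x \<in> space (M \<Otimes>\<^sub>M \<mu>). \<pi> (fst x) \<in> ball (snd x) r} =
      {x \<in> space (M \<Otimes>\<^sub>M \<mu>). dist (snd x) (\<pi> (fst x)) < r}" by auto
  then have [measurable]: "{x \<in> space (M \<Otimes>\<^sub>M \<mu>). \<pi> (fst x) \<in> ball (snd x) r} \<in> sets (M \<Otimes>\<^sub>M \<mu>)"
    by simp
  have meas: "(\<lambda>(z, y). indicator E z * indicator (ball y r) (\<pi> z) * ?w z) \<in> borel_measurable (M \<Otimes>\<^sub>M \<mu>)"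
    unfolding case_prod_beta indicator_def[of "ball _ _"] by measurable
  have "emeasure M E = (\<integral>\<^sup>+z. indicator E z \<partial>M)" by simp
  also have "\<dots> = (\<integral>\<^sup>+z. \<integral>\<^sup>+y. indicator E z * indicator (ball y r) (\<pi> z) * ?w z \<partial>\<mu> \<partial>M)"
  proof (intro nn_integral_cong)
    fix z assume "z \<in> space M"
    have "(\<integral>\<^sup>+y. indicator E z * indicator (ball y r) (\<pi> z) * ?w z \<partial>\<mu>) =
        (\<integral>\<^sup>+y. (indicator E z * ?w z) * indicator (ball (\<pi> z) r) y \<partial>\<mu>)"
      by (intro nn_integral_cong) (auto split: split_indicator simp: dist_commute)
    also have "\<dots> = (indicator E z * ?w z) * emeasure \<mu> (ball (\<pi> z) r)"
      using sets_\<mu> by (intro nn_integral_cmult_indicator) auto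
    also have "\<dots> = indicator E z"
    proof (cases "z \<in> E")
      case True
      then show ?thesis
        using pos[OF True] by (simp add: \<mu>.emeasure_eq_measure flip: ennreal_mult)
    qed simp
    finally show "indicator E z = (\<integral>\<^sup>+y. indicator E z * indicator (ball y r) (\<pi> z) * ?w z \<partial>\<mu>)" by simp
  qed
  also have "\<dots> = (\<integral>\<^sup>+y. \<integral>\<^sup>+z. indicator E z * indicator (ball y r) (\<pi> z) * ?w z \<partial>M \<partial>\<mu>)"
    using Fubini[OF meas] by simp
  also have "\<dots> \<le> (\<integral>\<^sup>+y. c \<partial>\<mu>)"
    by (intro nn_integral_mono le)
  also have "\<dots> = c" by (simp add: \<mu>.emeasure_space_1)
  finally show ?thesis .
qed

text \<open>Only times divisible by \<open>Suc p\<close> are examined: these are the returns of \<open>F ^^ Suc p\<close>, to which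
  Kac's inequality applies, and they all come after time \<open>p\<close>.\<close>

definition late_return :: "real \<Rightarrow> nat \<Rightarrow> real \<Rightarrow> 'z set" where
  "late_return e p r = {z\<in>space M. 0 < measure \<mu> (ball (\<pi> z) r) \<and>
     (\<forall>j. 1 \<le> j \<and> real j \<le> r powr - e / measure \<mu> (ball (\<pi> z) r) \<longrightarrow>
        2 * r \<le> dist (\<pi> ((F ^^ (Suc p * j)) z)) (\<pi> z))}"

lemma late_return_measurable[measurable]: "late_return e p r \<in> sets M"
  unfolding late_return_def by measurable

text \<open>Fix a centre \<open>y\<close> and let \<open>t\<close> be the time \<open>r powr - e / measure \<mu> (ball (\<pi> z) r)\<close>. A bad point \<open>z\<close> seen in
  \<open>ball y r\<close> avoids this ball up to time \<open>t\<close>, since the ball lies within \<open>2 * r\<close> of \<open>\<pi> z\<close>. Hence the weight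
  \<open>r powr e * t\<close> is at most \<open>r powr e\<close> times the number of \<open>n\<close> for which \<open>z\<close> has no return up to \<open>n\<close>, and the sum
  of the measures of these events is at most \<open>1\<close>.\<close>

lemma emeasure_late_return:
  assumes r: "0 < r"
  shows "emeasure M (late_return e p r) \<le> ennreal (r powr e)"
proof (rule emeasure_le_by_averaging[where r = r])
  fix y
  define G where "G = F ^^ Suc p"
  have G[measurable]: "G \<in> measurable M M" unfolding G_def by (rule funpow_measurable)
  have Gj: "G ^^ j = F ^^ (Suc p * j)" for j unfolding G_def by (simp only: funpow_mult mult.commute)
  define B where "B = \<pi> -` ball y r \<inter> space M"
  have B[measurable]: "B \<in> sets M" unfolding B_def by measurable
  define A where "A n = {z\<in>B. \<forall>j\<in>{1..n}. (G ^^ j) z \<notin> B}" for n :: nat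
  have A_alt: "A n = {z\<in>space M. z \<in> B \<and> (\<forall>j\<in>{1..n}. (G ^^ j) z \<notin> B)}" for n
    using sets.sets_into_space[OF B] unfolding A_def by auto
  have [measurable]: "G ^^ k \<in> measurable M M" for k by (rule measurable_compose_n) (rule G)
  have A[measurable]: "A n \<in> sets M" for n unfolding A_alt by measurable
  have "(\<integral>\<^sup>+z. indicator (late_return e p r) z * indicator (ball y r) (\<pi> z) *
               ennreal (1 / measure \<mu> (ball (\<pi> z) r)) \<partial>M) \<le>
      (\<integral>\<^sup>+z. ennreal (r powr e) * (\<Sum>n. indicator (A n) z) \<partial>M)"
  proof (intro nn_integral_mono)
    fix z assume zM: "z \<in> space M"
    show "indicator (late_return e p r) z * indicator (ball y r) (\<pi> z) *
               ennreal (1 / measure \<mu> (ball (\<pi> z) r)) \<le> ennreal (r powr e) * (\<Sum>n. indicator (A n) z)"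
    proof (cases "z \<in> late_return e p r \<and> \<pi> z \<in> ball y r")
      case True
      define t where "t = r powr - e / measure \<mu> (ball (\<pi> z) r)"
      have t: "t > 0" using True r unfolding late_return_def t_def by auto
      have zA: "z \<in> A n" if "real n < t" for n
      proof -
        have "(G ^^ j) z \<notin> B" if j: "j \<in> {1..n}" for j
        proof -
          have "2 * r \<le> dist (\<pi> ((G ^^ j) z)) (\<pi> z)"
            using True j \<open>real n < t\<close> unfolding late_return_def Gj t_def by auto
          moreover have "dist (\<pi> ((G ^^ j) z)) (\<pi> z) \<le> dist y (\<pi> ((G ^^ j) z)) + dist y (\<pi> z)"
            by (rule dist_triangle3)
          ultimately show ?thesis using True unfolding B_def by auto
        qed
        then show ?thesis using True zM unfolding A_def B_def by auto
      qed
      have "ennreal t \<le> ennreal (real (nat \<lceil>t\<rceil>))" by (intro ennreal_leI) linarith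
      also have "\<dots> = (\<Sum>n<nat \<lceil>t\<rceil>. 1)" by (simp add: ennreal_of_nat_eq_real_of_nat)
      also have "\<dots> = (\<Sum>n<nat \<lceil>t\<rceil>. indicator (A n) z)"
      proof (rule sum.cong)
        fix n assume "n \<in> {..<nat \<lceil>t\<rceil>}"
        then have "real n < t" using t by (simp add: less_ceiling_iff zless_nat_eq_int_zless)
        then show "1 = (indicator (A n) z :: ennreal)" using zA by simp
      qed simp
      also have "\<dots> \<le> (\<Sum>n. indicator (A n) z)" by (intro sum_le_suminf) auto
      finally have *: "ennreal t \<le> (\<Sum>n. indicator (A n) z)" .
      have "1 / measure \<mu> (ball (\<pi> z) r) = r powr e * t"
        using r unfolding t_def by (simp add: powr_minus)
      then show ?thesis
        using True r t mult_left_mono[OF *, of "ennreal (r powr e)"] by (simp add: ennreal_mult)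
    next
      case False
      then show ?thesis by (cases "z \<in> late_return e p r") simp_all
    qed
  qed
  also have "\<dots> = ennreal (r powr e) * (\<Sum>n. emeasure M (A n))"
    by (simp add: nn_integral_cmult nn_integral_suminf)
  also have "\<dots> \<le> ennreal (r powr e) * 1"
    unfolding A_def
    by (intro mult_left_mono suminf_emeasure_no_return_le_1 prob_space_axioms G B)
       (simp_all add: G_def funpow_preserving del: funpow.simps)
  finally show "(\<integral>\<^sup>+z. indicator (late_return e p r) z * indicator (ball y r) (\<pi> z) *
               ennreal (1 / measure \<mu> (ball (\<pi> z) r)) \<partial>M) \<le> ennreal (r powr e)" by simp
qed (auto simp: late_return_def intro: late_return_measurable[unfolded late_return_def])

lemma AE_eventually_not_in:
  assumes E[measurable]: "\<And>n. E n \<in> sets M"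
    and a: "0 \<le> a" "a < 1" "0 \<le> C" and le: "\<And>n. n \<ge> 1 \<Longrightarrow> emeasure M (E n) \<le> ennreal (C * a ^ n)"
  shows "AE z in M. eventually (\<lambda>n. z \<notin> E n) sequentially"
proof -
  have "AE z in M. eventually (\<lambda>n. z \<in> space M - E n) sequentially"
  proof (rule borel_cantelli_AE1)
    show "summable (\<lambda>n. measure M (E n))"
    proof (rule summable_comparison_test')
      show "summable (\<lambda>n. C * a ^ n)" using a by (intro summable_mult summable_geometric) simp
      show "norm (measure M (E n)) \<le> C * a ^ n" if "n \<ge> 1" for n
        using le[OF that] a by (simp add: emeasure_eq_measure ennreal_le_iff)
    qed
  qed (auto simp: less_top[symmetric])
  then show ?thesis by (auto elim!: eventually_mono)
qed

lemma AE_return_soon: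
  assumes e: "e > 0"
  shows "AE z in M. eventually (\<lambda>n. z \<notin> late_return e p ((1/5) ^ n)) sequentially"
proof (rule AE_eventually_not_in[where a = "(1/5) powr e" and C = 1])
  show "emeasure M (late_return e p ((1/5) ^ n)) \<le> ennreal (1 * ((1/5) powr e) ^ n)" for n
  proof -
    have "((1/5::real) ^ n) powr e = ((1/5) powr e) ^ n"
      by (simp add: powr_powr mult.commute flip: powr_realpow)
    then show ?thesis using emeasure_late_return[of "(1/5) ^ n" e p] by simp
  qed
  show "(1/5::real) powr e < 1" using e powr_less_mono2[of e "1/5" 1] by simp
qed auto

text \<open>A ball of radius \<open>r / 2\<close> that contains a point \<open>x\<close> is contained in \<open>ball x r\<close>. So the points whose
  balls have measure below \<open>r powr (d + 1)\<close> are covered by \<open>O(r^(-d))\<close> balls of at most this measure, and together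
  have measure \<open>O(r)\<close>.\<close>

lemma AE_measure_ball_ge:
  assumes "covered_polynomially d (UNIV :: 'x set)"
  shows "AE z in M. eventually (\<lambda>n. ((1/5) ^ n) powr (real d + 1) \<le> measure \<mu> (ball (\<pi> z) ((1/5) ^ n))) sequentially"
proof -
  obtain C where C: "C \<ge> 0" "\<And>r. 0 < r \<Longrightarrow> r < 1 \<Longrightarrow>
     \<exists>S. finite S \<and> real (card S) \<le> C * (1 / r) ^ d \<and> (UNIV :: 'x set) \<subseteq> (\<Union>s\<in>S. ball s r)"
    using assms unfolding covered_polynomially_def by auto
  define E where "E n = {z\<in>space M. measure \<mu> (ball (\<pi> z) ((1/5) ^ n)) < ((1/5) ^ n) powr (real d + 1)}" for n :: nat
  have "AE z in M. eventually (\<lambda>n. z \<notin> E n) sequentially"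
  proof (rule AE_eventually_not_in[where a = "1/5" and C = "C * 2 ^ d"])
    show "E n \<in> sets M" for n unfolding E_def by measurable
    fix n :: nat assume "n \<ge> 1"
    define r where "r = (1/5::real) ^ n"
    have r: "0 < r" "r < 1" unfolding r_def using \<open>n \<ge> 1\<close> by (auto simp: power_less_one_iff)
    obtain S where S: "finite S" "real (card S) \<le> C * (1 / (r/2)) ^ d" "(UNIV :: 'x set) \<subseteq> (\<Union>s\<in>S. ball s (r/2))"
      using C(2)[of "r/2"] r by auto
    define S' where "S' = {s\<in>S. measure \<mu> (ball s (r/2)) \<le> r powr (real d + 1)}"
    have bad: "{x. measure \<mu> (ball x r) < r powr (real d + 1)} \<subseteq> (\<Union>s\<in>S'. ball s (r/2))"
    proof clarify
      fix x assume x: "measure \<mu> (ball x r) < r powr (real d + 1)"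
      have "x \<in> (\<Union>s\<in>S. ball s (r/2))" using S(3) by blast
      then obtain s where s: "s \<in> S" "dist s x < r/2" unfolding UN_iff mem_ball by blast
      have "ball s (r/2) \<subseteq> ball x r"
      proof
        fix v assume "v \<in> ball s (r/2)"
        then show "v \<in> ball x r" using s(2) dist_triangle[of x v s] by (simp add: dist_commute)
      qed
      then have "s \<in> S'" using measure_ball_mono[of s "r/2" x r] x s(1) unfolding S'_def by auto
      then show "x \<in> (\<Union>s\<in>S'. ball s (r/2))" using s(2) by auto
    qed
    have "(\<Union>s\<in>S'. ball s (r/2)) \<in> sets \<mu>" using sets_\<mu> by (simp add: open_UN)
    then have "\<pi> -` (\<Union>s\<in>S'. ball s (r/2)) \<inter> space M \<in> sets M"
      by (rule measurable_sets[OF \<pi>_measurable])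
    then have "measure M (E n) \<le> measure M (\<pi> -` (\<Union>s\<in>S'. ball s (r/2)) \<inter> space M)"
      using bad by (intro finite_measure_mono) (auto simp: E_def r_def)
    also have "\<dots> = measure \<mu> (\<Union>s\<in>S'. ball s (r/2))"
    proof -
      have "measure \<mu> (\<Union>s\<in>S'. ball s (r/2)) = measure (distr M \<mu> \<pi>) (\<Union>s\<in>S'. ball s (r/2))"
        by (simp add: distr_\<pi>)
      then show ?thesis using sets_\<mu> by (simp add: measure_distr open_UN)
    qed
    also have "\<dots> \<le> (\<Sum>s\<in>S'. measure \<mu> (ball s (r/2)))"
      using S(1) sets_\<mu> unfolding S'_def by (intro measure_UNION_le) auto
    also have "\<dots> \<le> (\<Sum>s\<in>S'. r powr (real d + 1))"
      by (intro sum_mono) (auto simp: S'_def)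
    also have "\<dots> = real (card S') * r powr (real d + 1)" by simp
    also have "\<dots> \<le> (C * (1 / (r/2)) ^ d) * r powr (real d + 1)"
    proof (intro mult_right_mono)
      have "card S' \<le> card S" using S(1) unfolding S'_def by (intro card_mono) auto
      then show "real (card S') \<le> C * (1 / (r/2)) ^ d" using S(2) by linarith
    qed simp
    also have "\<dots> = C * 2 ^ d * r"
      using r by (simp add: powr_add powr_realpow power_divide)
    finally show "emeasure M (E n) \<le> ennreal (C * 2 ^ d * (1/5) ^ n)"
      unfolding r_def using C(1) by (simp add: emeasure_eq_measure)
  qed (use C(1) in auto)
  then show ?thesis
    unfolding E_def by (elim AE_mp) (auto intro!: AE_I2 elim!: eventually_mono)
qed

end

section \<open>Early returns under decay of correlations\<close>

text \<open>A Lipschitz function between the indicators of \<open>ball y (2 * r)\<close> and \<open>ball y (4 * r)\<close>.\<close>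

definition bump :: "'x::metric_space \<Rightarrow> real \<Rightarrow> 'x \<Rightarrow> real" where
  "bump y r u = max 0 (min 1 (2 - dist u y / (2 * r)))"

lemma bump_bounds: "0 \<le> bump y r u" "bump y r u \<le> 1"
  unfolding bump_def by auto

lemma bump_eq_1: "0 < r \<Longrightarrow> u \<in> ball y (2 * r) \<Longrightarrow> bump y r u = 1"
  unfolding bump_def by (simp add: dist_commute divide_le_eq max_def)

lemma bump_eq_0: "0 < r \<Longrightarrow> u \<notin> ball y (4 * r) \<Longrightarrow> bump y r u = 0"
  unfolding bump_def by (simp add: dist_commute field_simps max_def min_def)

lemma bump_diff_le:
  assumes "0 < r"
  shows "\<bar>bump y r u - bump y r v\<bar> \<le> 1 / (2 * r) * dist u v"
proof -
  have "\<bar>bump y r u - bump y r v\<bar> \<le> \<bar>dist u y / (2 * r) - dist v y / (2 * r)\<bar>"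
    unfolding bump_def by (auto simp: max_def min_def)
  also have "\<dots> = \<bar>dist u y - dist v y\<bar> / (2 * r)"
    using assms by (simp flip: diff_divide_distrib)
  also have "\<dots> \<le> dist u v / (2 * r)"
    using assms dist_triangle[of u y v] dist_triangle[of v y u]
    by (intro divide_right_mono) (auto simp: dist_commute)
  finally show ?thesis by simp
qed

lemma is_lipschitz_bump: "0 < r \<Longrightarrow> is_lipschitz (bump y r)"
  unfolding is_lipschitz_def
  by (intro exI[of _ "1 / (2 * r)"] lipschitz_onI) (auto simp: dist_real_def bump_diff_le[simplified])

lemma lipschitz_norm_bump:
  fixes y :: "'x::metric_space"
  assumes r: "0 < r" "r \<le> 1 / 2"
  shows "0 \<le> lipschitz_norm (bump y r)" "lipschitz_norm (bump y r) \<le> 1 / r"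
proof -
  have q: "\<bar>bump y r u - bump y r v\<bar> / dist u v \<le> 1 / (2 * r)" for u v :: 'x
    using bump_diff_le[OF r(1), of y u v] r by (cases "u = v") (simp_all add: divide_le_eq)
  have s1: "(SUP x. \<bar>bump y r x\<bar>) \<le> 1"
    by (rule cSUP_least) (auto simp: bump_bounds abs_of_nonneg)
  have s2: "(SUP (u, v). \<bar>bump y r u - bump y r v\<bar> / dist u v) \<le> 1 / (2 * r)"
    by (rule cSUP_least) (auto simp: q[simplified])
  have "1 / (2 * r) + 1 \<le> 1 / r" using r by (simp add: field_simps)
  then show "lipschitz_norm (bump y r) \<le> 1 / r"
    unfolding lipschitz_norm_def using s1 s2 by linarith
  have "0 \<le> (SUP x. \<bar>bump y r x\<bar>)"
    by (rule cSUP_upper2[of _ _ undefined]) (auto intro!: bdd_aboveI[of _ 1] simp: bump_bounds abs_of_nonneg)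
  moreover have "0 \<le> (SUP (u, v). \<bar>bump y r u - bump y r v\<bar> / dist u v)"
    by (rule cSUP_upper2[of _ _ "(undefined, undefined)"]) (auto intro!: bdd_aboveI[of _ "1 / (2 * r)"] simp: q[simplified])
  ultimately show "0 \<le> lipschitz_norm (bump y r)" unfolding lipschitz_norm_def by simp
qed

locale rapidly_mixing_observed_system = observed_system M F \<pi> \<mu>
  for M :: "'z measure" and F and \<pi> :: "'z \<Rightarrow> 'x::metric_space" and \<mu> +
  fixes \<delta> :: "nat \<Rightarrow> real"
  assumes rate: "\<And>q. q > 0 \<Longrightarrow> (\<lambda>n. \<delta> n * real n powr q) \<longlonglongrightarrow> 0"
    and decay: "\<And>n \<psi> \<phi>. n \<ge> 1 \<Longrightarrow> is_lipschitz \<psi> \<Longrightarrow> is_lipschitz \<phi> \<Longrightarrow>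
       \<bar>(\<integral>z. \<psi> (\<pi> ((F ^^ n) z)) * \<phi> (\<pi> z) \<partial>M) - (\<integral>x. \<psi> x \<partial>\<mu>) * (\<integral>x. \<phi> x \<partial>\<mu>)\<bar>
         \<le> lipschitz_norm \<psi> * lipschitz_norm \<phi> * \<delta> n"
begin

lemma rate_bound:
  assumes "q > 0"
  obtains C where "C \<ge> 0" "\<And>n. n \<ge> 1 \<Longrightarrow> \<bar>\<delta> n\<bar> \<le> C * real n powr - q"
proof -
  have "Bseq (\<lambda>n. \<delta> n * real n powr q)"
    using rate[OF assms] by (intro convergent_imp_Bseq convergentI)
  then obtain C where C: "C > 0" "\<And>n. \<bar>\<delta> n * real n powr q\<bar> \<le> C"
    unfolding Bseq_def by auto
  have "\<bar>\<delta> n\<bar> \<le> C * real n powr - q" if "n \<ge> 1" for n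
    using C(2)[of n] that by (simp add: abs_mult powr_minus field_simps)
  then show ?thesis using that C(1) by (meson less_imp_le)
qed

lemma bump_measurable[measurable]: "bump (y :: 'x) r \<in> borel_measurable borel"
proof -
  have "(\<lambda>u :: 'x. dist u y) \<in> borel_measurable borel" by measurable
  then show ?thesis unfolding bump_def[abs_def] by measurable
qed

text \<open>Correlation of the bump function with itself at time \<open>n\<close>; the factor \<open>(1 / r)\<^sup>2\<close> comes from its
  Lipschitz norm, which enters the decay of correlations twice.\<close>

lemma measure_two_visits_le:
  assumes r: "0 < r" "r \<le> 1 / 2" and n: "n \<ge> 1"
  shows "measure M {z\<in>space M. \<pi> z \<in> ball y (2 * r) \<and> \<pi> ((F ^^ n) z) \<in> ball y (2 * r)}
    \<le> (measure \<mu> (ball y (4 * r)))\<^sup>2 + (1 / r)\<^sup>2 * \<bar>\<delta> n\<bar>"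
proof -
  let ?A = "{z\<in>space M. \<pi> z \<in> ball y (2 * r) \<and> \<pi> ((F ^^ n) z) \<in> ball y (2 * r)}"
  let ?\<phi> = "bump y r"
  have A: "?A \<in> sets M" unfolding mem_ball by measurable
  have m: "0 \<le> (\<integral>x. ?\<phi> x \<partial>\<mu>)" by (intro integral_nonneg_AE AE_I2 bump_bounds)
  have "(\<integral>x. ?\<phi> x \<partial>\<mu>) \<le> (\<integral>x. indicator (ball y (4 * r)) x \<partial>\<mu>)"
  proof (rule integral_mono)
    have "?\<phi> \<in> borel_measurable \<mu>" using bump_measurable by measurable
    then show "integrable \<mu> ?\<phi>"
      by (intro \<mu>.integrable_const_bound[where B = 1]) (auto simp: bump_bounds)
    show "integrable \<mu> (indicator (ball y (4 * r)) :: 'x \<Rightarrow> real)"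
      using sets_\<mu> by (intro integrable_real_indicator) (auto simp: less_top[symmetric])
    show "?\<phi> x \<le> indicator (ball y (4 * r)) x" for x
      using bump_bounds[of y r x] bump_eq_0[OF r(1), of x y] by (auto split: split_indicator)
  qed
  also have "\<dots> = measure \<mu> (ball y (4 * r))" using sets_\<mu> by simp
  finally have int: "(\<integral>x. ?\<phi> x \<partial>\<mu>) \<le> measure \<mu> (ball y (4 * r))" .
  have "measure M ?A = (\<integral>z. indicator ?A z \<partial>M)" using A by simp
  also have "\<dots> \<le> (\<integral>z. ?\<phi> (\<pi> ((F ^^ n) z)) * ?\<phi> (\<pi> z) \<partial>M)"
  proof (rule integral_mono)
    show "integrable M (indicator ?A :: 'z \<Rightarrow> real)"
      using A by (intro integrable_real_indicator) (auto simp: less_top[symmetric])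
    show "integrable M (\<lambda>z. ?\<phi> (\<pi> ((F ^^ n) z)) * ?\<phi> (\<pi> z))"
      by (intro integrable_const_bound[where B = 1])
         (auto simp: abs_mult bump_bounds intro!: mult_le_one)
    show "indicator ?A z \<le> ?\<phi> (\<pi> ((F ^^ n) z)) * ?\<phi> (\<pi> z)" for z
    proof (cases "z \<in> ?A")
      case True
      then have "?\<phi> (\<pi> z) = 1" "?\<phi> (\<pi> ((F ^^ n) z)) = 1"
        by (auto intro!: bump_eq_1[OF r(1)])
      then show ?thesis using True by simp
    qed (simp add: bump_bounds)
  qed
  also have "\<dots> \<le> (\<integral>x. ?\<phi> x \<partial>\<mu>) * (\<integral>x. ?\<phi> x \<partial>\<mu>) + lipschitz_norm ?\<phi> * lipschitz_norm ?\<phi> * \<delta> n"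
    using decay[OF n is_lipschitz_bump[OF r(1), of y] is_lipschitz_bump[OF r(1), of y]] by linarith
  also have "(\<integral>x. ?\<phi> x \<partial>\<mu>) * (\<integral>x. ?\<phi> x \<partial>\<mu>) \<le> (measure \<mu> (ball y (4 * r)))\<^sup>2"
    unfolding power2_eq_square using int m by (intro mult_mono) auto
  also have "lipschitz_norm ?\<phi> * lipschitz_norm ?\<phi> * \<delta> n \<le> (1 / r)\<^sup>2 * \<bar>\<delta> n\<bar>"
  proof -
    have "lipschitz_norm ?\<phi> * lipschitz_norm ?\<phi> * \<delta> n \<le> lipschitz_norm ?\<phi> * lipschitz_norm ?\<phi> * \<bar>\<delta> n\<bar>"
      by (intro mult_left_mono) auto
    also have "\<dots> \<le> (1 / r * (1 / r)) * \<bar>\<delta> n\<bar>"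
      using lipschitz_norm_bump[OF r, of y] r by (intro mult_right_mono mult_mono) auto
    finally show ?thesis by (simp add: power2_eq_square)
  qed
  finally show ?thesis by simp
qed

text \<open>The radius \<open>5 * r\<close> is chosen so that \<open>ball (\<pi> z) (5 * r)\<close> contains the support \<open>ball y (4 * r)\<close> of the bump
  function around every centre \<open>y\<close> at distance less than \<open>r\<close> from \<open>\<pi> z\<close>. The first two conditions bound the
  weight \<open>1 / measure \<mu> (ball (\<pi> z) r)\<close> used in averaging, absolutely and in terms of the ball around \<open>y\<close>.\<close>

definition early_return :: "real \<Rightarrow> real \<Rightarrow> real \<Rightarrow> 'z set" where
  "early_return e D r = {z\<in>space M. r powr D \<le> measure \<mu> (ball (\<pi> z) r) \<and>
     measure \<mu> (ball (\<pi> z) (5 * r)) \<le> r powr - e * measure \<mu> (ball (\<pi> z) r) \<and>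
     (\<exists>k. r powr - e \<le> real k \<and> real k \<le> r powr (2 * e) / measure \<mu> (ball (\<pi> z) (5 * r)) \<and>
        dist (\<pi> ((F ^^ k) z)) (\<pi> z) < r)}"

lemma early_return_measurable[measurable]: "early_return e D r \<in> sets M"
proof -
  have m: "(\<lambda>z. measure \<mu> (ball (\<pi> z) s)) \<in> borel_measurable M" for s
    by (rule measurable_compose[OF \<pi>_borel measure_ball_measurable])
  have w: "{z\<in>space M. r powr D \<le> measure \<mu> (ball (\<pi> z) r)} \<in> sets M"
    "{z\<in>space M. measure \<mu> (ball (\<pi> z) (5 * r)) \<le> r powr - e * measure \<mu> (ball (\<pi> z) r)} \<in> sets M"
    by (intro borel_measurable_le borel_measurable_times borel_measurable_const m)+
  have t: "{z\<in>space M. real k \<le> r powr (2 * e) / measure \<mu> (ball (\<pi> z) (5 * r))} \<in> sets M"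
    "{z\<in>space M. dist (\<pi> ((F ^^ k) z)) (\<pi> z) < r} \<in> sets M" for k
    by (intro borel_measurable_le borel_measurable_less borel_measurable_divide borel_measurable_const m
          dist_measurable measurable_compose[OF funpow_measurable \<pi>_borel] \<pi>_borel)+
  have "early_return e D r = {z\<in>space M. r powr D \<le> measure \<mu> (ball (\<pi> z) r)} \<inter>
      {z\<in>space M. measure \<mu> (ball (\<pi> z) (5 * r)) \<le> r powr - e * measure \<mu> (ball (\<pi> z) r)} \<inter>
      (\<Union>k\<in>{k. r powr - e \<le> real k}.
        {z\<in>space M. real k \<le> r powr (2 * e) / measure \<mu> (ball (\<pi> z) (5 * r))} \<inter>
        {z\<in>space M. dist (\<pi> ((F ^^ k) z)) (\<pi> z) < r})"
    unfolding early_return_def by blast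
  also have "\<dots> \<in> sets M"
    by (intro sets.Int sets.countable_UN'' w t countableI_type)
  finally show ?thesis .
qed

text \<open>Fix a centre \<open>y\<close> and let \<open>\<beta>\<close> be the measure of \<open>ball y (4 * r)\<close>. For bad points near \<open>y\<close> the weight is at most
  \<open>r powr - e / \<beta>\<close> and the return time \<open>k\<close> is one of at most \<open>r powr (2 * e) / \<beta>\<close> values, each of which
  corresponds to two visits to \<open>ball y (2 * r)\<close>, an event of measure \<open>O(\<beta>\<^sup>2)\<close>. The product of the three
  bounds is \<open>O(r powr e)\<close>.\<close>

lemma emeasure_early_return:
  assumes e: "e > 0" and D: "D \<ge> 0"
  obtains C where "C \<ge> 0"
    "\<And>r. 0 < r \<Longrightarrow> r \<le> 1 / 2 \<Longrightarrow> emeasure M (early_return e D r) \<le> ennreal (C * r powr e)"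
proof -
  \<comment> \<open>for \<open>k \<ge> r powr - e\<close> this makes \<open>k powr - q \<le> r powr (2 + 2 * D)\<close>, so that after multiplication
      with \<open>(1 / r)\<^sup>2\<close> at most \<open>(r powr D)\<^sup>2\<close> is left\<close>
  define q where "q = (2 + 2 * D) / e"
  have q: "q > 0" using e D unfolding q_def by simp
  obtain C where C: "C \<ge> 0" "\<And>n. n \<ge> 1 \<Longrightarrow> \<bar>\<delta> n\<bar> \<le> C * real n powr - q"
    using rate_bound[OF q] by blast
  have "emeasure M (early_return e D r) \<le> ennreal ((1 + C) * r powr e)"
    if r: "0 < r" "r \<le> 1 / 2" for r
  proof (rule emeasure_le_by_averaging[where r = r])
    show "0 < measure \<mu> (ball (\<pi> z) r)" if "z \<in> early_return e D r" for z
    proof -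
      have "r powr D \<le> measure \<mu> (ball (\<pi> z) r)" using that unfolding early_return_def by blast
      moreover have "0 < r powr D" using r by simp
      ultimately show ?thesis by linarith
    qed
    fix y
    define \<beta> where "\<beta> = measure \<mu> (ball y (4 * r))"
    define J where "J = {k. r powr - e \<le> real k \<and> real k \<le> r powr (2 * e) / \<beta>}"
    define V where "V k = {z\<in>space M. \<pi> z \<in> ball y (2 * r) \<and> \<pi> ((F ^^ k) z) \<in> ball y (2 * r)}" for k
    have V[measurable]: "V k \<in> sets M" for k unfolding V_def mem_ball by measurable
    have near: "r powr D \<le> \<beta>" "1 / measure \<mu> (ball (\<pi> z) r) \<le> r powr - e / \<beta>" "\<exists>k\<in>J. z \<in> V k"
      if z: "z \<in> early_return e D r" "\<pi> z \<in> ball y r" for z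
    proof -
      let ?w = "measure \<mu> (ball (\<pi> z) r)" and ?w5 = "measure \<mu> (ball (\<pi> z) (5 * r))"
      have w: "r powr D \<le> ?w" "?w5 \<le> r powr - e * ?w" using z(1) unfolding early_return_def by auto
      have "0 < r powr D" using r by simp
      have "ball (\<pi> z) r \<subseteq> ball y (4 * r)"
      proof
        fix v assume "v \<in> ball (\<pi> z) r"
        then show "v \<in> ball y (4 * r)" using z(2) r dist_triangle[of y v "\<pi> z"] by simp
      qed
      then have "?w \<le> \<beta>" unfolding \<beta>_def by (rule measure_ball_mono)
      have "ball y (4 * r) \<subseteq> ball (\<pi> z) (5 * r)"
      proof
        fix v assume "v \<in> ball y (4 * r)"
        then show "v \<in> ball (\<pi> z) (5 * r)"
          using z(2) r dist_triangle[of "\<pi> z" v y] by (simp add: dist_commute)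
      qed
      then have "\<beta> \<le> ?w5" unfolding \<beta>_def by (rule measure_ball_mono)
      show "r powr D \<le> \<beta>" using w \<open>?w \<le> \<beta>\<close> by linarith
      then have "\<beta> > 0" using \<open>0 < r powr D\<close> by linarith
      show "1 / ?w \<le> r powr - e / \<beta>"
      proof -
        have "0 < ?w" "\<beta> \<le> r powr - e * ?w" using \<open>\<beta> \<le> ?w5\<close> w \<open>0 < r powr D\<close> by linarith+
        then show ?thesis using \<open>\<beta> > 0\<close> by (simp add: field_simps)
      qed
      obtain k where k: "r powr - e \<le> real k" "real k \<le> r powr (2 * e) / ?w5"
        "dist (\<pi> ((F ^^ k) z)) (\<pi> z) < r"
        using z(1) unfolding early_return_def by auto
      have "r powr (2 * e) / ?w5 \<le> r powr (2 * e) / \<beta>"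
        using \<open>\<beta> \<le> ?w5\<close> \<open>\<beta> > 0\<close> by (intro divide_left_mono) auto
      then have "k \<in> J" using k unfolding J_def by auto
      moreover have "z \<in> V k"
        using z(1) z(2) k(3) r dist_triangle[of y "\<pi> ((F ^^ k) z)" "\<pi> z"]
        unfolding V_def early_return_def by (auto simp: dist_commute)
      ultimately show "\<exists>k\<in>J. z \<in> V k" by blast
    qed
    show "(\<integral>\<^sup>+z. indicator (early_return e D r) z * indicator (ball y r) (\<pi> z) *
               ennreal (1 / measure \<mu> (ball (\<pi> z) r)) \<partial>M) \<le> ennreal ((1 + C) * r powr e)"
    proof (cases "r powr D \<le> \<beta>")
      case False
      then have "indicator (early_return e D r) z * indicator (ball y r) (\<pi> z) = (0 :: ennreal)" for z
        using near(1)[of z] by (auto split: split_indicator)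
      then show ?thesis by (simp del: mult_eq_0_iff)
    next
      case True
      have "0 < r powr D" using r by simp
      then have \<beta>: "\<beta> > 0" using True by linarith
      have k1: "k \<ge> 1" if "k \<in> J" for k
      proof -
        have "0 < r powr - e" using r by simp
        moreover have "r powr - e \<le> real k" using that unfolding J_def by simp
        ultimately have "0 < real k" by linarith
        then show ?thesis by simp
      qed
      have "J \<subseteq> {1..nat \<lfloor>r powr (2 * e) / \<beta>\<rfloor>}"
        using k1 unfolding J_def by (auto simp: le_nat_floor)
      then have J: "finite J" "card J \<le> nat \<lfloor>r powr (2 * e) / \<beta>\<rfloor>"
        using finite_subset card_mono[of "{1..nat \<lfloor>r powr (2 * e) / \<beta>\<rfloor>}" J] by auto
      have cardJ: "real (card J) \<le> r powr (2 * e) / \<beta>"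
      proof -
        have "real (card J) \<le> real (nat \<lfloor>r powr (2 * e) / \<beta>\<rfloor>)" using J(2) by simp
        also have "\<dots> \<le> r powr (2 * e) / \<beta>" using \<beta> by (intro of_nat_floor) simp
        finally show ?thesis .
      qed
      have V_le: "measure M (V k) \<le> \<beta>\<^sup>2 * (1 + C)" if k: "k \<in> J" for k
      proof -
        have "real k powr - q \<le> (r powr - e) powr - q"
          using k q r unfolding J_def by (intro powr_mono2') auto
        also have "\<dots> = r powr (2 + 2 * D)" using e by (simp add: powr_powr q_def add.commute)
        also have "\<dots> = r powr 2 * (r powr D * r powr D)" by (simp flip: powr_add)
        also have "\<dots> = r\<^sup>2 * (r powr D)\<^sup>2"
          using r by (simp add: power2_eq_square[of "r powr D"])
        finally have *: "real k powr - q \<le> r\<^sup>2 * (r powr D)\<^sup>2" .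
        have "measure M (V k) \<le> \<beta>\<^sup>2 + (1 / r)\<^sup>2 * \<bar>\<delta> k\<bar>"
          unfolding V_def \<beta>_def by (rule measure_two_visits_le[OF r k1[OF k]])
        also have "\<dots> \<le> \<beta>\<^sup>2 + (1 / r)\<^sup>2 * (C * (r\<^sup>2 * (r powr D)\<^sup>2))"
          using C(2)[OF k1[OF k]] mult_left_mono[OF * C(1)]
          by (intro add_left_mono mult_left_mono) auto
        also have "\<dots> = \<beta>\<^sup>2 + C * (r powr D)\<^sup>2" using r by (simp add: power_divide)
        also have "\<dots> \<le> \<beta>\<^sup>2 + C * \<beta>\<^sup>2"
          using True C(1) by (intro add_left_mono mult_left_mono power_mono) auto
        finally show ?thesis by (simp add: algebra_simps)
      qed
      have "(\<integral>\<^sup>+z. indicator (early_return e D r) z * indicator (ball y r) (\<pi> z) *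
               ennreal (1 / measure \<mu> (ball (\<pi> z) r)) \<partial>M) \<le>
          (\<integral>\<^sup>+z. (\<Sum>k\<in>J. ennreal (r powr - e / \<beta>) * indicator (V k) z) \<partial>M)"
      proof (intro nn_integral_mono)
        fix z
        show "indicator (early_return e D r) z * indicator (ball y r) (\<pi> z) *
               ennreal (1 / measure \<mu> (ball (\<pi> z) r)) \<le> (\<Sum>k\<in>J. ennreal (r powr - e / \<beta>) * indicator (V k) z)"
        proof (cases "z \<in> early_return e D r \<and> \<pi> z \<in> ball y r")
          case True
          then obtain k where k: "k \<in> J" "z \<in> V k" using near(3) by blast
          have "ennreal (1 / measure \<mu> (ball (\<pi> z) r)) \<le> ennreal (r powr - e / \<beta>) * indicator (V k) z"
            using True k near(2) by (simp add: ennreal_leI)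
          also have "\<dots> \<le> (\<Sum>k\<in>J. ennreal (r powr - e / \<beta>) * indicator (V k) z)"
            using k J(1) by (intro member_le_sum) auto
          finally show ?thesis using True by simp
        qed (auto split: split_indicator)
      qed
      also have "\<dots> = (\<Sum>k\<in>J. ennreal (r powr - e / \<beta>) * emeasure M (V k))"
        by (simp add: nn_integral_sum nn_integral_cmult_indicator)
      also have "\<dots> \<le> (\<Sum>k\<in>J. ennreal (r powr - e / \<beta> * (\<beta>\<^sup>2 * (1 + C))))"
      proof (rule sum_mono)
        fix k assume k: "k \<in> J"
        have "r powr - e / \<beta> * measure M (V k) \<le> r powr - e / \<beta> * (\<beta>\<^sup>2 * (1 + C))"
          using V_le[OF k] \<beta> by (intro mult_left_mono) auto
        then show "ennreal (r powr - e / \<beta>) * emeasure M (V k) \<le> ennreal (r powr - e / \<beta> * (\<beta>\<^sup>2 * (1 + C)))"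
          using \<beta> unfolding emeasure_eq_measure by (subst ennreal_mult[symmetric]) (auto intro: ennreal_leI)
      qed
      also have "\<dots> = ennreal (real (card J) * (r powr - e / \<beta> * (\<beta>\<^sup>2 * (1 + C))))"
        using \<beta> C(1) by (simp add: ennreal_of_nat_eq_real_of_nat flip: ennreal_mult)
      also have "\<dots> \<le> ennreal (r powr (2 * e) / \<beta> * (r powr - e / \<beta> * (\<beta>\<^sup>2 * (1 + C))))"
        using cardJ \<beta> C(1) by (intro ennreal_leI mult_right_mono) auto
      also have "r powr (2 * e) / \<beta> * (r powr - e / \<beta> * (\<beta>\<^sup>2 * (1 + C))) = (1 + C) * (r powr (2 * e) * r powr - e)"
        using \<beta> by (simp add: power2_eq_square)
      also have "r powr (2 * e) * r powr - e = r powr e" by (simp flip: powr_add)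
      finally show ?thesis .
    qed
  qed (rule early_return_measurable)
  then show ?thesis using that[of "1 + C"] C(1) by simp
qed

lemma AE_no_early_return:
  assumes e: "e > 0" and D: "D \<ge> 0"
  shows "AE z in M. eventually (\<lambda>n. z \<notin> early_return e D ((1/5) ^ n)) sequentially"
proof -
  obtain C where C: "C \<ge> 0"
    "\<And>r. 0 < r \<Longrightarrow> r \<le> 1 / 2 \<Longrightarrow> emeasure M (early_return e D r) \<le> ennreal (C * r powr e)"
    using emeasure_early_return[OF assms] by blast
  show ?thesis
  proof (rule AE_eventually_not_in[where a = "(1/5) powr e" and C = C])
    show "emeasure M (early_return e D ((1/5) ^ n)) \<le> ennreal (C * ((1/5) powr e) ^ n)" if "n \<ge> 1" for n
    proof -
      have "((1/5::real) ^ n) powr e = ((1/5) powr e) ^ n"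
        by (simp add: powr_powr mult.commute flip: powr_realpow)
      moreover have "(1/5::real) ^ n \<le> (1/5) ^ 1" using that by (intro power_decreasing) auto
      ultimately show ?thesis using C(2)[of "(1/5) ^ n"] by simp
    qed
    show "(1/5::real) powr e < 1" using e powr_less_mono2[of e "1/5" 1] by simp
  qed (use C(1) in auto)
qed

end

section \<open>Recurrence rates from estimates along geometric scales\<close>

lemma elog_mono: "a \<le> b \<Longrightarrow> elog a \<le> elog b"
  by (cases a; cases b) (auto simp: elog_def)

lemma return_time_le:
  "p < k \<Longrightarrow> dist (rds_iter \<theta> T k \<omega> x) x < r \<Longrightarrow> return_time \<theta> T r p \<omega> x \<le> enat k"
  unfolding return_time_def by (intro Inf_lower) auto

lemma return_time_mono: "p \<le> q \<Longrightarrow> return_time \<theta> T r p \<omega> x \<le> return_time \<theta> T r q \<omega> x"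
  unfolding return_time_def by (intro Inf_superset_mono) auto

lemma ln_le_elog_return_time:
  assumes "0 < b" "\<And>k. p < k \<Longrightarrow> dist (rds_iter \<theta> T k \<omega> x) x < r \<Longrightarrow> b \<le> real k"
  shows "ereal (ln b) \<le> elog (ereal_of_enat (return_time \<theta> T r p \<omega> x))"
proof (cases "return_time \<theta> T r p \<omega> x")
  case (enat k)
  let ?S = "{enat k | k. k > p \<and> dist (rds_iter \<theta> T k \<omega> x) x < r}"
  have "?S \<noteq> {}"
  proof
    assume "?S = {}"
    then have "return_time \<theta> T r p \<omega> x = Inf {}" unfolding return_time_def by (rule arg_cong)
    then show False using enat by (simp add: top_enat_def)
  qed
  then obtain i where "i \<in> ?S" by (auto simp only: ex_in_conv[symmetric])
  then have "Inf ?S \<in> ?S" by (rule wellorder_InfI)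
  then have "b \<le> real k" using enat assms(2) unfolding return_time_def by auto
  then have "ereal (ln b) \<le> elog (ereal (real k))"
    using assms(1) by (simp add: elog_def)
  then show ?thesis using enat by simp
qed (simp add: elog_def)

abbreviation return_exponent ::
    "('w \<Rightarrow> 'w) \<Rightarrow> ('w \<Rightarrow> 'x::metric_space \<Rightarrow> 'x) \<Rightarrow> 'w \<Rightarrow> 'x \<Rightarrow> nat \<Rightarrow> real \<Rightarrow> ereal" where
  "return_exponent \<theta> T \<omega> x p r \<equiv> elog (ereal_of_enat (return_time \<theta> T r p \<omega> x)) / ereal (- ln r)"

lemma eventually_less_one_at_right_0: "eventually (\<lambda>r::real. 0 < r \<and> r < 1) (at_right 0)"
  using eventually_at_right_real[of 0 1] by simp

lemma return_exponent_mono: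
  assumes "p \<le> q"
  shows "eventually (\<lambda>r. return_exponent \<theta> T \<omega> x p r \<le> return_exponent \<theta> T \<omega> x q r) (at_right 0)"
  using eventually_less_one_at_right_0
proof eventually_elim
  case (elim r)
  have "elog (ereal_of_enat (return_time \<theta> T r p \<omega> x)) \<le> elog (ereal_of_enat (return_time \<theta> T r q \<omega> x))"
    using return_time_mono[OF assms] by (intro elog_mono) simp
  then show ?case using elim by (intro ereal_divide_right_mono) auto
qed

text \<open>Raising \<open>p\<close> raises the return time, so the limit in the definition of the rates is a
  supremum.\<close>

lemma lower_recurrence_rate_eq_SUP:
  "lower_recurrence_rate \<theta> T \<omega> x = (SUP p. Liminf (at_right 0) (return_exponent \<theta> T \<omega> x p))"
  unfolding lower_recurrence_rate_def
  by (intro limI LIMSEQ_SUP monoI Liminf_mono return_exponent_mono)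

lemma upper_recurrence_rate_eq_SUP:
  "upper_recurrence_rate \<theta> T \<omega> x = (SUP p. Limsup (at_right 0) (return_exponent \<theta> T \<omega> x p))"
  unfolding upper_recurrence_rate_def
  by (intro limI LIMSEQ_SUP monoI Limsup_mono return_exponent_mono)

lemma scale_powr: "((1/5::real) ^ n) powr a = 5 powr (- (a * real n))"
proof -
  have "(1/5::real) ^ n = inverse (5 ^ n)" by (simp add: power_one_over inverse_eq_divide)
  also have "\<dots> = 5 powr (- real n)" by (simp add: powr_minus powr_realpow)
  finally show ?thesis by (simp add: powr_powr mult.commute)
qed

lemma obtain_scale:
  fixes r :: real
  assumes "0 < r" "r \<le> (1/5) ^ N"
  obtains n where "N \<le> n" "(1/5) ^ Suc n < r" "r \<le> (1/5) ^ n"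
proof -
  define m where "m = (LEAST n. (1/5) ^ n < r)"
  have "\<exists>n. (1/5) ^ n < r" using assms(1) by (intro real_arch_pow_inv) auto
  then have m: "(1/5) ^ m < r" unfolding m_def by (rule LeastI_ex)
  have "N < m"
  proof (rule ccontr)
    assume "\<not> N < m"
    then have "(1/5::real) ^ N \<le> (1/5) ^ m" by (intro power_decreasing) auto
    then show False using m assms(2) by linarith
  qed
  then obtain n where n: "m = Suc n" "N \<le> n" by (cases m) auto
  have "\<not> (1/5) ^ n < r"
    using not_less_Least[of n "\<lambda>n. (1/5) ^ n < r"] n(1) unfolding m_def by simp
  then show ?thesis using that n m by simp
qed

lemma ereal_le_add_fractions:
  fixes a b :: ereal
  assumes "\<And>j. J \<le> j \<Longrightarrow> a \<le> b + ereal (c * (1 / real (Suc j)))"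
  shows "a \<le> b"
proof (rule LIMSEQ_le_const)
  have "(\<lambda>j. ereal (c * (1 / real (Suc j)))) \<longlonglongrightarrow> ereal (c * 0)"
    using LIMSEQ_inverse_real_of_nat by (intro tendsto_ereal tendsto_mult tendsto_const) (simp add: inverse_eq_divide)
  then have "(\<lambda>j. b + ereal (c * (1 / real (Suc j)))) \<longlonglongrightarrow> b + ereal (c * 0)"
    by (intro tendsto_add_ereal_general tendsto_const) auto
  then show "(\<lambda>j. b + ereal (c * (1 / real (Suc j)))) \<longlonglongrightarrow> b" by simp
  show "\<exists>N. \<forall>n\<ge>N. a \<le> b + ereal (c * (1 / real (Suc n)))" using assms by blast
qed

text \<open>From here on the point and its orbit are fixed. The lower bound on the measure of balls keeps their
  exponents bounded, so that adding a constant to \<open>ln r\<close> does not affect limits.\<close>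

locale ball_growth =
  fixes \<mu> :: "'x::metric_space measure" and x :: 'x and D :: real
  assumes prob: "prob_space \<mu>" and borel: "sets \<mu> = sets borel" and D: "0 < D"
    and lower: "eventually (\<lambda>n. ((1/5) ^ n) powr D \<le> measure \<mu> (ball x ((1/5) ^ n))) sequentially"
begin

definition mass :: "real \<Rightarrow> real" where "mass r = measure \<mu> (ball x r)"

definition exponent :: "real \<Rightarrow> real" where "exponent r = ln (mass r) / ln r"

lemma mass_mono: "r \<le> s \<Longrightarrow> mass r \<le> mass s"
proof -
  interpret prob_space \<mu> by (rule prob)
  show "r \<le> s \<Longrightarrow> mass r \<le> mass s"
    unfolding mass_def using borel by (intro finite_measure_mono subset_ball) auto
qed

lemma mass_le_1: "mass r \<le> 1"
  unfolding mass_def using prob by (rule prob_space.prob_le_1)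

text \<open>Doubling the exponent absorbs the passage from a radius to the next smaller power of
  \<open>1/5\<close>.\<close>

lemma eventually_mass_ge: "eventually (\<lambda>r. 0 < r \<and> r < 1 \<and> r powr (2 * D) \<le> mass r) (at_right 0)"
proof -
  obtain N where N: "\<And>n. N \<le> n \<Longrightarrow> ((1/5) ^ n) powr D \<le> mass ((1/5) ^ n)"
    using lower unfolding mass_def eventually_sequentially by blast
  have "eventually (\<lambda>r. r \<in> {0<..<(1/5) ^ Suc N}) (at_right (0::real))"
    by (rule eventually_at_right_real) simp
  then show ?thesis
  proof eventually_elim
    case (elim r)
    have r: "0 < r" "r \<le> (1/5) ^ Suc N" using elim by auto
    have r5: "r \<le> 1/5" using r(2) power_le_one[of "1/5::real" N] by simp
    obtain n where n: "Suc N \<le> n" "(1/5) ^ Suc n < r" "r \<le> (1/5) ^ n"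
      using obtain_scale[OF r] .
    have "r powr (2 * D) = (r * r) powr D" using r by (simp add: powr_mult flip: powr_add)
    also have "\<dots> \<le> (1/5 * r) powr D"
      using r r5 D by (intro powr_mono2 mult_right_mono) auto
    also have "\<dots> \<le> ((1/5) ^ Suc n) powr D"
      using n(3) r D by (intro powr_mono2) auto
    also have "\<dots> \<le> mass ((1/5) ^ Suc n)" using n(1) by (intro N) simp
    also have "\<dots> \<le> mass r" using n(2) by (intro mass_mono) simp
    finally show ?case using r r5 by simp
  qed
qed

lemma mass_pos: "0 < r \<Longrightarrow> 0 < mass r"
proof -
  assume r: "0 < r"
  have "eventually (\<lambda>s. s \<in> {0<..<r}) (at_right (0::real))"
    using r by (rule eventually_at_right_real)
  with eventually_mass_ge have "eventually (\<lambda>s. 0 < s \<and> s powr (2 * D) \<le> mass s \<and> s < r) (at_right 0)"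
    by eventually_elim auto
  then obtain s where s: "0 < s" "s powr (2 * D) \<le> mass s" "s < r"
    using eventually_happens'[OF trivial_limit_at_right_real] by blast
  have "0 < s powr (2 * D)" using s(1) by simp
  also have "\<dots> \<le> mass s" by (rule s(2))
  also have "\<dots> \<le> mass r" using s(3) by (intro mass_mono) simp
  finally show "0 < mass r" .
qed

lemma eventually_exponent: "eventually (\<lambda>r. 0 \<le> exponent r \<and> exponent r \<le> 2 * D) (at_right 0)"
  using eventually_mass_ge
proof eventually_elim
  case (elim r)
  then have r: "0 < r" "r < 1" "r powr (2 * D) \<le> mass r" by auto
  have "ln (mass r) \<le> 0" using mass_le_1 mass_pos[OF r(1)] by simp
  moreover have "ln r < 0" using r by simp
  moreover have "ln (r powr (2 * D)) \<le> ln (mass r)" using r mass_pos[OF r(1)] by (subst ln_le_cancel_iff) auto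
  then have "2 * D * ln r \<le> ln (mass r)" using r by (simp add: ln_powr)
  ultimately show ?case
    unfolding exponent_def by (auto simp: divide_nonpos_neg divide_le_eq)
qed

lemma filterlim_scale: "0 < c \<Longrightarrow> filterlim (\<lambda>r. c * r) (at_right 0) (at_right (0::real))"
  using filtermap_times_pos_at_right[of c 0] unfolding filterlim_def by simp

text \<open>Multiplying the radius by a constant maps the filter at \<open>0\<close> to itself. This absorbs the constants by which
  the radii of balls and of returns differ in the estimates below.\<close>

lemma local_dim_rescale:
  assumes c: "0 < c"
  shows "lower_local_dim \<mu> x = Liminf (at_right 0) (\<lambda>r. ereal (exponent (c * r)))"
    and "upper_local_dim \<mu> x = Limsup (at_right 0) (\<lambda>r. ereal (exponent (c * r)))"
proof -
  have ev: "eventually (\<lambda>r. elog (ereal (measure \<mu> (ball x r))) / ereal (ln r) = ereal (exponent r)) (at_right 0)"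
    using eventually_less_one_at_right_0
  proof eventually_elim
    case (elim r)
    then show ?case using mass_pos[of r] unfolding mass_def[symmetric] by (simp add: elog_def exponent_def)
  qed
  have inj: "inj (\<lambda>r. c * r)" using c by (auto simp: inj_def)
  have filt: "filtermap (\<lambda>r. c * r) (at_right 0) = at_right 0"
    using filtermap_times_pos_at_right[OF c, of 0] by simp
  have "lower_local_dim \<mu> x = Liminf (filtermap (\<lambda>r. c * r) (at_right 0)) (\<lambda>r. ereal (exponent r))"
    unfolding lower_local_dim_def filt using ev by (rule Liminf_eq)
  then show "lower_local_dim \<mu> x = Liminf (at_right 0) (\<lambda>r. ereal (exponent (c * r)))"
    using Liminf_filtermap_eq[OF inj] by (simp only:)
  have "upper_local_dim \<mu> x = Limsup (filtermap (\<lambda>r. c * r) (at_right 0)) (\<lambda>r. ereal (exponent r))"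
    unfolding upper_local_dim_def filt using ev by (rule Limsup_eq)
  then show "upper_local_dim \<mu> x = Limsup (at_right 0) (\<lambda>r. ereal (exponent (c * r)))"
    using Limsup_filtermap_eq[OF inj] by (simp only:)
qed

lemma eventually_minus_ln_ge: "eventually (\<lambda>r::real. b \<le> - ln r) (at_right 0)"
proof -
  have "eventually (\<lambda>r::real. r \<in> {0<..<exp (- b)}) (at_right 0)"
    by (rule eventually_at_right_real) simp
  then show ?thesis
  proof eventually_elim
    case (elim r)
    then have "ln r \<le> ln (exp (- b))" by (subst ln_le_cancel_iff) auto
    then show ?case by simp
  qed
qed

text \<open>Compare \<open>r\<close> with the largest scale \<open>s\<close> below \<open>r / 2\<close>, which is at least \<open>r / 10\<close>. Constant factors in the bound for
  the return time become negligible against \<open>- ln r\<close> and cost one of the two \<open>e\<close>.\<close>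

lemma return_exponent_le:
  assumes e: "0 < e"
    and soon: "eventually (\<lambda>n. \<exists>k>p. real k \<le> real (Suc p) * (((1/5) ^ n) powr - e / mass ((1/5) ^ n)) \<and>
       dist (rds_iter \<theta> T k \<omega> x) x < 2 * (1/5) ^ n) sequentially"
  shows "eventually (\<lambda>r. return_exponent \<theta> T \<omega> x p r \<le> ereal (exponent (1/10 * r)) + ereal (2 * e)) (at_right 0)"
proof -
  obtain N where N: "\<And>n. N \<le> n \<Longrightarrow> \<exists>k>p. real k \<le> real (Suc p) * (((1/5) ^ n) powr - e / mass ((1/5) ^ n)) \<and>
       dist (rds_iter \<theta> T k \<omega> x) x < 2 * (1/5) ^ n"
    using soon unfolding eventually_sequentially by blast
  have small: "eventually (\<lambda>r. r \<in> {0<..<(1/5) ^ N}) (at_right (0::real))"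
    by (rule eventually_at_right_real) simp
  have exp10: "eventually (\<lambda>r. 0 \<le> exponent (1/10 * r) \<and> exponent (1/10 * r) \<le> 2 * D) (at_right 0)"
    by (rule eventually_compose_filterlim[OF eventually_exponent filterlim_scale]) simp
  have "eventually (\<lambda>r::real. (ln (real (Suc p)) + e * ln 10 + 2 * D * ln 10) / e \<le> - ln r) (at_right 0)"
    by (rule eventually_minus_ln_ge)
  with small exp10 eventually_less_one_at_right_0 show ?thesis
  proof eventually_elim
    case (elim r)
    then have r: "0 < r" "r < 1" by auto
    define L where "L = - ln r"
    have L: "0 < L" using r unfolding L_def by simp
    have "r / 2 \<le> (1/5) ^ N" using elim(1) r by (simp; linarith)
    then obtain n where n: "N \<le> n" "(1/5) ^ Suc n < r/2" "r/2 \<le> (1/5) ^ n"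
      using obtain_scale[of "r/2" N] r by auto
    define s where "s = (1/5::real) ^ Suc n"
    have s: "0 < s" "2 * s < r" "1/10 * r \<le> s" using n unfolding s_def by auto
    obtain k where k: "p < k" "real k \<le> real (Suc p) * (s powr - e / mass s)"
      "dist (rds_iter \<theta> T k \<omega> x) x < 2 * s"
      using N[of "Suc n"] n(1) unfolding s_def by auto
    have w10: "0 < mass (1/10 * r)" using r by (intro mass_pos) simp
    have "s powr - e / mass s \<le> (1/10 * r) powr - e / mass (1/10 * r)"
      using s r e w10 by (intro frac_le powr_mono2' mass_mono) auto
    then have "real k \<le> real (Suc p) * ((1/10 * r) powr - e / mass (1/10 * r))"
      using k(2) by (meson mult_left_mono of_nat_0_le_iff order_trans)
    then have "ln (real k) \<le> ln (real (Suc p) * ((1/10 * r) powr - e / mass (1/10 * r)))"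
      using k(1) r w10 by (subst ln_le_cancel_iff) auto
    also have "\<dots> = ln (real (Suc p)) + e * (L + ln 10) - ln (mass (1/10 * r))"
      using r w10 by (simp add: ln_mult ln_div ln_powr L_def algebra_simps del: of_nat_Suc)
    finally have "ln (real k) \<le> ln (real (Suc p)) + e * (L + ln 10) - ln (mass (1/10 * r))" .
    moreover have "- ln (mass (1/10 * r)) = exponent (1/10 * r) * (L + ln 10)"
    proof -
      have "ln (1/10 * r) = - (L + ln 10)" using r by (simp add: ln_div L_def)
      then have "exponent (1/10 * r) = ln (mass (1/10 * r)) / - (L + ln 10)"
        unfolding exponent_def by (simp only:)
      moreover have "L + ln 10 > 0" using L by (simp add: add_pos_pos)
      ultimately show ?thesis by (simp add: divide_minus_right del: minus_add_distrib)
    qed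
    ultimately have "ln (real k) \<le> ln (real (Suc p)) + e * (L + ln 10) + exponent (1/10 * r) * (L + ln 10)"
      by linarith
    moreover have "exponent (1/10 * r) * ln 10 \<le> 2 * D * ln 10"
      using elim(2) by (intro mult_right_mono) auto
    moreover have "ln (real (Suc p)) + e * ln 10 + 2 * D * ln 10 \<le> e * L"
      using elim(4) e unfolding L_def by (simp add: divide_le_eq mult.commute)
    ultimately have "ln (real k) \<le> (exponent (1/10 * r) + 2 * e) * L"
      unfolding distrib_left distrib_right by linarith
    then have le: "ln (real k) / L \<le> exponent (1/10 * r) + 2 * e" using L by (simp add: divide_le_eq)
    have "return_time \<theta> T r p \<omega> x \<le> enat k"
      using k(1,3) s(2) by (intro return_time_le) auto
    then have "elog (ereal_of_enat (return_time \<theta> T r p \<omega> x)) \<le> elog (ereal_of_enat (enat k))"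
      by (intro elog_mono) (simp del: ereal_of_enat_simps)
    also have "\<dots> = ereal (ln (real k))" using k(1) by (simp add: elog_def)
    finally have "return_exponent \<theta> T \<omega> x p r \<le> ereal (ln (real k)) / ereal L"
      using L unfolding L_def by (intro ereal_divide_right_mono) auto
    also have "\<dots> = ereal (ln (real k) / L)" using L by simp
    also have "\<dots> \<le> ereal (exponent (1/10 * r)) + ereal (2 * e)" using le by simp
    finally show ?case .
  qed
qed

text \<open>This is the condition of \<open>early_return\<close> that may fail at some scales; the other condition on the measure
  of balls holds eventually.\<close>

definition steady_scale :: "real \<Rightarrow> nat \<Rightarrow> bool" where
  "steady_scale e n \<longleftrightarrow> mass (5 * (1/5) ^ n) \<le> ((1/5) ^ n) powr - e * mass ((1/5) ^ n)"

text \<open>Suppose that none of the scales \<open>m + 1, \<dots>, m + K\<close> is steady. Each of them loses at least a factor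
  \<open>5^(e * m)\<close> of mass, so that the mass at scale \<open>m + K\<close> is at most \<open>5^(- e * m * K)\<close>, against the lower bound
  \<open>5^(- D * (m + K))\<close>. For \<open>K > 2 * D / e\<close> and \<open>m > K\<close> this is impossible.\<close>

lemma steady_scale_gaps:
  assumes e: "0 < e"
  obtains K N where "\<And>m. N \<le> m \<Longrightarrow> \<exists>n. m < n \<and> n \<le> m + K \<and> steady_scale e n"
proof -
  obtain N0 where N0: "\<And>n. N0 \<le> n \<Longrightarrow> ((1/5) ^ n) powr D \<le> mass ((1/5) ^ n)"
    using lower unfolding mass_def eventually_sequentially by blast
  obtain K where K: "2 * D / e < real K" using reals_Archimedean2 by blast
  have K0: "real K * e > 2 * D" using K e by (simp add: divide_less_eq)
  have "\<exists>n. m < n \<and> n \<le> m + K \<and> steady_scale e n" if m: "max N0 (Suc K) \<le> m" for m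
  proof (rule ccontr)
    assume no: "\<not> (\<exists>n. m < n \<and> n \<le> m + K \<and> steady_scale e n)"
    have "j \<le> K \<Longrightarrow> mass ((1/5) ^ (m + j)) \<le> (1/5) powr (real m * e * real j)" for j
    proof (induction j)
      case 0
      show ?case using mass_le_1 by simp
    next
      case (Suc j)
      define n where "n = m + Suc j"
      have "\<not> steady_scale e n" using no Suc.prems unfolding n_def by auto
      then have "((1/5) ^ n) powr - e * mass ((1/5) ^ n) < mass ((1/5) ^ (m + j))"
        unfolding steady_scale_def n_def by simp
      then have "mass ((1/5) ^ n) < ((1/5) ^ n) powr e * mass ((1/5) ^ (m + j))"
        by (simp add: powr_minus field_simps)
      also have "\<dots> \<le> (1/5) powr (real m * e) * (1/5) powr (real m * e * real j)"
      proof (intro mult_mono)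
        have "((1/5::real) ^ n) powr e = (1/5) powr (real n * e)"
          by (simp add: powr_powr flip: powr_realpow)
        also have "\<dots> \<le> (1/5) powr (real m * e)"
          using e by (intro powr_mono') (auto simp: n_def)
        finally show "((1/5::real) ^ n) powr e \<le> (1/5) powr (real m * e)" .
        show "mass ((1/5) ^ (m + j)) \<le> (1/5) powr (real m * e * real j)"
          using Suc by simp
      qed (auto simp: mass_def)
      also have "\<dots> = (1/5) powr (real m * e * real (Suc j))"
        by (simp add: algebra_simps flip: powr_add)
      finally show ?case unfolding n_def by simp
    qed
    then have "mass ((1/5) ^ (m + K)) \<le> (1/5) powr (real m * e * real K)" by simp
    moreover have "((1/5) ^ (m + K)) powr D \<le> mass ((1/5) ^ (m + K))" using m by (intro N0) simp
    moreover have "((1/5::real) ^ (m + K)) powr D = (1/5) powr (real (m + K) * D)"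
      by (simp add: powr_powr flip: powr_realpow)
    ultimately have "(1/5::real) powr (real (m + K) * D) \<le> (1/5) powr (real m * e * real K)" by simp
    then have "\<not> real (m + K) * D < real m * e * real K"
      using powr_less_mono'[of "1/5::real" "real (m + K) * D" "real m * e * real K"] by linarith
    moreover have "real (m + K) * D < (2 * real m) * D" using m D by (intro mult_strict_right_mono) auto
    moreover have "real m * (2 * D) \<le> real m * (real K * e)" using K0 by (intro mult_left_mono) auto
    ultimately show False by (simp add: algebra_simps)
  qed
  then show ?thesis using that by blast
qed

text \<open>At a steady scale \<open>n\<close> the hypothesis controls the times from \<open>5^(e * n)\<close> on. A smaller time \<open>k > p\<close> is
  controlled at some steady scale \<open>n'\<close>, chosen between about \<open>y / 2\<close> and \<open>y\<close> for \<open>k = 5^(e * y)\<close>: the lower bound on \<open>n'\<close>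
  and the assumption on the dimension keep \<open>k\<close> below the upper end of the range at \<open>n'\<close>. As \<open>n' \<le> n\<close>, the distance
  obtained at \<open>n'\<close> is at least as large. Hence no time after \<open>p\<close> and up to the upper end of the range
  at \<open>n\<close> is a return, and a general radius is compared with a steady scale at most \<open>K\<close> steps larger.\<close>

lemma le_return_exponent:
  assumes e: "0 < e"
    and late: "eventually (\<lambda>n. steady_scale e n \<longrightarrow>
      (\<forall>k. ((1/5) ^ n) powr - e \<le> real k \<and> real k \<le> ((1/5) ^ n) powr (2 * e) / mass (5 * (1/5) ^ n) \<longrightarrow>
         (1/5) ^ n \<le> dist (rds_iter \<theta> T k \<omega> x) x)) sequentially"
    and dim: "ereal (4 * e) < lower_local_dim \<mu> x"
  obtains p c where "0 < c"
    "eventually (\<lambda>r. ereal (exponent (c * r)) + ereal (- (3 * e)) \<le> return_exponent \<theta> T \<omega> x p r) (at_right 0)"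
proof -
  obtain N1 where N1: "\<And>n k. N1 \<le> n \<Longrightarrow> steady_scale e n \<Longrightarrow> ((1/5) ^ n) powr - e \<le> real k \<Longrightarrow>
      real k \<le> ((1/5) ^ n) powr (2 * e) / mass (5 * (1/5) ^ n) \<Longrightarrow> (1/5) ^ n \<le> dist (rds_iter \<theta> T k \<omega> x) x"
    using late unfolding eventually_sequentially by blast
  have "eventually (\<lambda>r. ereal (4 * e) < ereal (exponent (1 * r))) (at_right 0)"
    using dim unfolding local_dim_rescale(1)[OF zero_less_one] by (rule less_LiminfD)
  with eventually_less_one_at_right_0 have "eventually (\<lambda>r. mass r \<le> r powr (4 * e)) (at_right 0)"
  proof eventually_elim
    case (elim r)
    then have "4 * e < ln (mass r) / ln r" "ln r < 0" unfolding exponent_def by auto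
    then have "ln (mass r) < 4 * e * ln r" by (simp add: less_divide_eq)
    then have "exp (ln (mass r)) \<le> exp (4 * e * ln r)" by simp
    then show ?case using mass_pos[of r] elim by (simp add: powr_def)
  qed
  then obtain \<rho> where \<rho>: "0 < \<rho>" "\<And>r. 0 < r \<Longrightarrow> r < \<rho> \<Longrightarrow> mass r \<le> r powr (4 * e)"
    unfolding eventually_at_right_field by blast
  obtain N2 where N2: "(1/5) ^ N2 < \<rho> / 5"
    using real_arch_pow_inv[of "\<rho> / 5" "1/5"] \<rho>(1) by auto
  have w5: "mass (5 * (1/5) ^ n) \<le> 5 powr (4 * e) * ((1/5) ^ n) powr (4 * e)" if "N2 \<le> n" for n
  proof -
    have "(1/5::real) ^ n \<le> (1/5) ^ N2" using that by (intro power_decreasing) auto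
    then have "5 * (1/5) ^ n < \<rho>" using N2 by linarith
    then show ?thesis using \<rho>(2)[of "5 * (1/5) ^ n"] by (simp add: powr_mult)
  qed
  obtain K N3 where gaps: "\<And>m. N3 \<le> m \<Longrightarrow> \<exists>n. m < n \<and> n \<le> m + K \<and> steady_scale e n"
    using steady_scale_gaps[OF e] by blast
  define N where "N = max N1 (max N2 N3)"
  \<comment> \<open>for \<open>k = 5 powr (e * y)\<close> with \<open>k > p\<close>, the interval from \<open>y / 2 + 2\<close> to \<open>y\<close> contains
      \<open>K\<close> consecutive scales beyond \<open>N\<close>\<close>
  define p where "p = nat \<lceil>5 powr (e * real (2 * (N + K + 4)))\<rceil>"
  have p_scale: "\<exists>n\<ge>N. steady_scale e n \<and> 5 powr (e * real n) \<le> real k \<and> (1/5) ^ n \<le> dist (rds_iter \<theta> T k \<omega> x) x"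
    if k: "p < k" for k
  proof -
    have k0: "5 powr (e * real (2 * (N + K + 4))) \<le> real k" using k unfolding p_def by linarith
    have kpos: "0 < real k" using k by simp
    define y where "y = log 5 (real k) / e"
    have ky: "real k = 5 powr (e * y)" using e kpos unfolding y_def by simp
    have y: "2 * real N + 2 * real K + 8 \<le> y"
    proof -
      have "e * real (2 * (N + K + 4)) \<le> e * y" using k0 unfolding ky by (simp del: of_nat_mult)
      then have "real (2 * (N + K + 4)) \<le> y" using e by (simp del: of_nat_mult)
      then show ?thesis by simp
    qed
    define m where "m = nat \<lceil>y / 2\<rceil> + 1"
    have m: "y / 2 + 1 \<le> real m" "real m \<le> y / 2 + 2" using y unfolding m_def by linarith+
    have "N \<le> m" using m(1) y by linarith
    then have "N3 \<le> m" unfolding N_def by simp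
    then obtain n where n: "m < n" "n \<le> m + K" "steady_scale e n" using gaps by blast
    have "N \<le> n" using n(1) \<open>N \<le> m\<close> by simp
    have n_le: "real n \<le> y" using n(2) m(2) y by linarith
    have n_ge: "y / 2 + 2 \<le> real n" using n(1) m(1) by linarith
    define s where "s = (1/5::real) ^ n"
    have s_powr: "s powr a = 5 powr (- (a * real n))" for a
      unfolding s_def by (rule scale_powr)
    have a: "5 powr (e * real n) \<le> real k" unfolding ky using n_le e by simp
    have w5s: "0 < mass (5 * s)" by (intro mass_pos) (simp add: s_def)
    have "real k * mass (5 * s) \<le> 5 powr (e * y) * (5 powr (4 * e) * s powr (4 * e))"
      using w5[of n] \<open>N \<le> n\<close> unfolding ky s_def N_def by (intro mult_left_mono) auto
    also have "\<dots> = 5 powr (e * y + (4 * e - 4 * e * real n))"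
      unfolding s_powr by (simp flip: powr_add)
    also have "\<dots> \<le> 5 powr (- (2 * e * real n))"
    proof -
      have "e * (y + 4) \<le> e * (2 * real n)" using n_ge e by (intro mult_left_mono) auto
      then show ?thesis by (simp add: algebra_simps)
    qed
    also have "\<dots> = s powr (2 * e)" unfolding s_powr by simp
    finally have "real k \<le> s powr (2 * e) / mass (5 * s)" using w5s by (simp add: le_divide_eq)
    moreover have "s powr - e \<le> real k" using a unfolding s_powr by simp
    ultimately have "s \<le> dist (rds_iter \<theta> T k \<omega> x) x"
      using N1[of n k] n(3) \<open>N \<le> n\<close> unfolding s_def N_def by simp
    then show ?thesis using n(3) a \<open>N \<le> n\<close> unfolding s_def by blast
  qed
  have far: "(1/5) ^ n \<le> dist (rds_iter \<theta> T k \<omega> x) x"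
    if n: "N \<le> n" "steady_scale e n" and k: "p < k" "real k \<le> ((1/5) ^ n) powr (2 * e) / mass (5 * (1/5) ^ n)" for n k
  proof (cases "((1/5) ^ n) powr - e \<le> real k")
    case True
    then show ?thesis using N1[of n k] n k unfolding N_def by simp
  next
    case False
    obtain n' where n': "5 powr (e * real n') \<le> real k" "(1/5) ^ n' \<le> dist (rds_iter \<theta> T k \<omega> x) x"
      using p_scale[OF k(1)] by blast
    have "((1/5::real) ^ n) powr - e = 5 powr (e * real n)"
      unfolding scale_powr by simp
    then have "5 powr (e * real n') < 5 powr (e * real n)" using False n'(1) by linarith
    then have "n' \<le> n" using e by simp
    then have "(1/5::real) ^ n \<le> (1/5) ^ n'" by (intro power_decreasing) auto
    then show ?thesis using n'(2) by linarith
  qed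
  define c where "c = (5::real) ^ Suc K"
  have c: "0 < c" unfolding c_def by simp
  have small: "eventually (\<lambda>r. r \<in> {0<..<(1/5) ^ (N + K)}) (at_right (0::real))"
    by (rule eventually_at_right_real) simp
  have exp_c: "eventually (\<lambda>r. 0 \<le> exponent (c * r) \<and> exponent (c * r) \<le> 2 * D) (at_right 0)"
    by (rule eventually_compose_filterlim[OF eventually_exponent filterlim_scale[OF c]])
  have less_c: "eventually (\<lambda>r. 0 < c * r \<and> c * r < 1) (at_right 0)"
    by (rule eventually_compose_filterlim[OF eventually_less_one_at_right_0 filterlim_scale[OF c]])
  have "eventually (\<lambda>r::real. 2 * D * ln c / e \<le> - ln r) (at_right 0)"
    by (rule eventually_minus_ln_ge)
  with small exp_c less_c eventually_less_one_at_right_0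
  have "eventually (\<lambda>r. ereal (exponent (c * r)) + ereal (- (3 * e)) \<le> return_exponent \<theta> T \<omega> x p r) (at_right 0)"
  proof eventually_elim
    case (elim r)
    then have r: "0 < r" "r < 1" "r \<le> (1/5) ^ (N + K)" by auto
    define L where "L = - ln r"
    have L: "0 < L" using r unfolding L_def by simp
    obtain m where m: "N + K \<le> m" "(1/5) ^ Suc m < r" "r \<le> (1/5) ^ m"
      using obtain_scale[OF r(1,3)] .
    have "N3 \<le> N" unfolding N_def by simp
    then have "N3 \<le> m - K" using m(1) by linarith
    then obtain n where n: "m - K < n" "n \<le> m - K + K" "steady_scale e n" using gaps by blast
    define s where "s = (1/5::real) ^ n"
    have "r \<le> s"
    proof -
      have "(1/5::real) ^ m \<le> s" unfolding s_def using n(2) m(1) by (intro power_decreasing) auto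
      then show ?thesis using m(3) by linarith
    qed
    have "5 * s \<le> c * r"
    proof -
      have "s \<le> (1/5) ^ (Suc m - K)" unfolding s_def using n(1) m(1) by (intro power_decreasing) auto
      also have "\<dots> = 5 ^ K * (1/5) ^ Suc m"
        using m(1) by (simp add: power_diff power_one_over divide_simps)
      also have "\<dots> \<le> 5 ^ K * r" using m(2) by simp
      finally show ?thesis unfolding c_def by simp
    qed
    define b where "b = r powr (2 * e) / mass (c * r)"
    have wc: "0 < mass (c * r)" using r c by (intro mass_pos) simp
    have w5s: "0 < mass (5 * s)" by (intro mass_pos) (simp add: s_def)
    have b: "0 < b" using r wc unfolding b_def by simp
    have b_le: "b \<le> s powr (2 * e) / mass (5 * s)"
      unfolding b_def using \<open>r \<le> s\<close> \<open>5 * s \<le> c * r\<close> r e w5s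
      by (intro frac_le powr_mono2 mass_mono) auto
    have "ereal (ln b) \<le> elog (ereal_of_enat (return_time \<theta> T r p \<omega> x))"
    proof (rule ln_le_elog_return_time[OF b])
      fix k assume k: "p < k" "dist (rds_iter \<theta> T k \<omega> x) x < r"
      show "b \<le> real k"
      proof (rule ccontr)
        assume "\<not> b \<le> real k"
        then have "real k \<le> s powr (2 * e) / mass (5 * s)" using b_le by linarith
        then have "s \<le> dist (rds_iter \<theta> T k \<omega> x) x"
          using far[of n k] n m(1) k(1) unfolding s_def by simp
        then show False using k(2) \<open>r \<le> s\<close> by linarith
      qed
    qed
    then have "ereal (ln b) / ereal L \<le> return_exponent \<theta> T \<omega> x p r"
      using L unfolding L_def by (intro ereal_divide_right_mono) auto
    moreover have "exponent (c * r) - 3 * e \<le> ln b / L"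
    proof -
      have ln_cr: "ln (c * r) = - (L - ln c)" using r c by (simp add: ln_mult L_def)
      have "ln (c * r) < 0" using elim(3) by simp
      then have "0 < L - ln c" unfolding ln_cr by linarith
      moreover have "exponent (c * r) = ln (mass (c * r)) / - (L - ln c)"
        unfolding exponent_def ln_cr by (rule refl)
      ultimately have "- ln (mass (c * r)) = exponent (c * r) * (L - ln c)"
        by (simp add: divide_minus_right del: minus_diff_eq)
      moreover have "ln b = - (2 * e * L) - ln (mass (c * r))"
        unfolding b_def using r wc by (simp add: ln_div ln_powr L_def)
      moreover have "exponent (c * r) * ln c \<le> 2 * D * ln c"
        using elim(2) unfolding c_def by (intro mult_right_mono) (auto intro!: ln_ge_zero simp del: power_Suc)
      moreover have "2 * D * ln c \<le> e * L"
        using elim(5) e unfolding L_def by (simp add: divide_le_eq mult.commute)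
      ultimately have "(exponent (c * r) - 3 * e) * L \<le> ln b" by (simp add: algebra_simps)
      then show ?thesis using L by (simp add: le_divide_eq)
    qed
    ultimately show ?case using L by (simp add: order_trans[rotated])
  qed
  then show ?thesis using that c by blast
qed

lemma recurrence_rates_le:
  assumes "\<And>p j. eventually (\<lambda>n. \<exists>k>p. real k \<le> real (Suc p) * (((1/5) ^ n) powr - (1 / real (Suc j)) / mass ((1/5) ^ n)) \<and>
       dist (rds_iter \<theta> T k \<omega> x) x < 2 * (1/5) ^ n) sequentially"
  shows "lower_recurrence_rate \<theta> T \<omega> x \<le> lower_local_dim \<mu> x"
    and "upper_recurrence_rate \<theta> T \<omega> x \<le> upper_local_dim \<mu> x"
proof -
  have ev: "eventually (\<lambda>r. return_exponent \<theta> T \<omega> x p r \<le>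
      ereal (exponent (1/10 * r)) + ereal (2 * (1 / real (Suc j)))) (at_right 0)" for p j
    by (rule return_exponent_le) (use assms in auto)
  have c: "(0::real) < 1/10" by simp
  show "lower_recurrence_rate \<theta> T \<omega> x \<le> lower_local_dim \<mu> x"
    unfolding lower_recurrence_rate_eq_SUP
  proof (rule SUP_least, rule ereal_le_add_fractions[where J = 0])
    fix p j :: nat
    have "Liminf (at_right 0) (return_exponent \<theta> T \<omega> x p) \<le>
        Liminf (at_right 0) (\<lambda>r. ereal (exponent (1/10 * r)) + ereal (2 * (1 / real (Suc j))))"
      by (rule Liminf_mono[OF ev])
    then show "Liminf (at_right 0) (return_exponent \<theta> T \<omega> x p) \<le> lower_local_dim \<mu> x + ereal (2 * (1 / real (Suc j)))"
      unfolding local_dim_rescale(1)[OF c] by (subst (asm) Liminf_add_ereal_right) auto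
  qed
  show "upper_recurrence_rate \<theta> T \<omega> x \<le> upper_local_dim \<mu> x"
    unfolding upper_recurrence_rate_eq_SUP
  proof (rule SUP_least, rule ereal_le_add_fractions[where J = 0])
    fix p j :: nat
    have "Limsup (at_right 0) (return_exponent \<theta> T \<omega> x p) \<le>
        Limsup (at_right 0) (\<lambda>r. ereal (exponent (1/10 * r)) + ereal (2 * (1 / real (Suc j))))"
      by (rule Limsup_mono[OF ev])
    then show "Limsup (at_right 0) (return_exponent \<theta> T \<omega> x p) \<le> upper_local_dim \<mu> x + ereal (2 * (1 / real (Suc j)))"
      unfolding local_dim_rescale(2)[OF c] by (subst (asm) Limsup_add_ereal_right) auto
  qed
qed

lemma recurrence_rates_ge:
  assumes late: "\<And>j. eventually (\<lambda>n. steady_scale (1 / real (Suc j)) n \<longrightarrow>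
      (\<forall>k. ((1/5) ^ n) powr - (1 / real (Suc j)) \<le> real k \<and>
           real k \<le> ((1/5) ^ n) powr (2 * (1 / real (Suc j))) / mass (5 * (1/5) ^ n) \<longrightarrow>
         (1/5) ^ n \<le> dist (rds_iter \<theta> T k \<omega> x) x)) sequentially"
    and dim: "0 < lower_local_dim \<mu> x"
  shows "lower_local_dim \<mu> x \<le> lower_recurrence_rate \<theta> T \<omega> x"
    and "upper_local_dim \<mu> x \<le> upper_recurrence_rate \<theta> T \<omega> x"
proof -
  obtain a where a: "0 < a" "ereal a < lower_local_dim \<mu> x"
    using ereal_dense2[OF dim] by (auto simp: zero_ereal_def)
  obtain J where J: "4 / a < real (Suc J)" using reals_Archimedean2 by (metis lift_Suc_mono_less_iff less_trans of_nat_less_iff lessI)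
  have bounds: "lower_local_dim \<mu> x \<le> lower_recurrence_rate \<theta> T \<omega> x + ereal (3 * (1 / real (Suc j)))"
    "upper_local_dim \<mu> x \<le> upper_recurrence_rate \<theta> T \<omega> x + ereal (3 * (1 / real (Suc j)))" if "J \<le> j" for j
  proof -
    define e where "e = 1 / real (Suc j)"
    have e: "0 < e" unfolding e_def by simp
    have "4 / a < real (Suc j)" using J that by simp
    then have "4 * e < a" using a(1) unfolding e_def by (simp add: field_simps)
    then have "ereal (4 * e) < lower_local_dim \<mu> x" using a(2) by (meson ereal_less_eq(3) less_imp_le order.strict_trans1)
    from le_return_exponent[OF e late[of j, folded e_def] this]
    obtain p c where c: "0 < c" and ev:
      "eventually (\<lambda>r. ereal (exponent (c * r)) + ereal (- (3 * e)) \<le> return_exponent \<theta> T \<omega> x p r) (at_right 0)" .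
    have "lower_local_dim \<mu> x + ereal (- (3 * e)) \<le> Liminf (at_right 0) (return_exponent \<theta> T \<omega> x p)"
      using Liminf_mono[OF ev] unfolding local_dim_rescale(1)[OF c] by (subst (asm) Liminf_add_ereal_right) auto
    also have "\<dots> \<le> lower_recurrence_rate \<theta> T \<omega> x"
      unfolding lower_recurrence_rate_eq_SUP by (rule SUP_upper) simp
    finally show "lower_local_dim \<mu> x \<le> lower_recurrence_rate \<theta> T \<omega> x + ereal (3 * (1 / real (Suc j)))"
      unfolding e_def[symmetric]
      by (cases "lower_local_dim \<mu> x"; cases "lower_recurrence_rate \<theta> T \<omega> x") auto
    have "upper_local_dim \<mu> x + ereal (- (3 * e)) \<le> Limsup (at_right 0) (return_exponent \<theta> T \<omega> x p)"
      using Limsup_mono[OF ev] unfolding local_dim_rescale(2)[OF c] by (subst (asm) Limsup_add_ereal_right) auto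
    also have "\<dots> \<le> upper_recurrence_rate \<theta> T \<omega> x"
      unfolding upper_recurrence_rate_eq_SUP by (rule SUP_upper) simp
    finally show "upper_local_dim \<mu> x \<le> upper_recurrence_rate \<theta> T \<omega> x + ereal (3 * (1 / real (Suc j)))"
      unfolding e_def[symmetric]
      by (cases "upper_local_dim \<mu> x"; cases "upper_recurrence_rate \<theta> T \<omega> x") auto
  qed
  show "lower_local_dim \<mu> x \<le> lower_recurrence_rate \<theta> T \<omega> x"
    by (rule ereal_le_add_fractions[OF bounds(1)])
  show "upper_local_dim \<mu> x \<le> upper_recurrence_rate \<theta> T \<omega> x"
    by (rule ereal_le_add_fractions[OF bounds(2)])
qed

end

section \<open>Random dynamical systems\<close>

lemma skew_product_funpow:
  "(skew_product \<theta> T ^^ k) (\<omega>, x) = ((\<theta> ^^ k) \<omega>, rds_iter \<theta> T k \<omega> x)"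
  by (induction k) (auto simp: skew_product_def)

lemma is_lipschitz_measurable:
  fixes f :: "'x::metric_space \<Rightarrow> real"
  assumes "is_lipschitz f"
  shows "f \<in> borel_measurable borel"
proof -
  obtain C where "C-lipschitz_on UNIV f" using assms unfolding is_lipschitz_def by blast
  then show ?thesis by (intro borel_measurable_continuous_onI lipschitz_on_continuous_on)
qed

lemma is_lipschitz_bounded:
  fixes f :: "'x::metric_space \<Rightarrow> real"
  assumes "compact (UNIV :: 'x set)" "is_lipschitz f"
  obtains B where "\<And>x. \<bar>f x\<bar> \<le> B"
proof -
  obtain C where "C-lipschitz_on UNIV f" using assms(2) unfolding is_lipschitz_def by blast
  then have "bounded (range f)"
    by (intro compact_imp_bounded compact_continuous_image assms(1) lipschitz_on_continuous_on)
  then show ?thesis using that unfolding bounded_iff by auto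
qed

context rapidly_mixing_observed_system
begin

text \<open>The exceptional sets depend on \<open>e\<close> and \<open>p\<close>; taking \<open>e\<close> of the form \<open>1 / Suc j\<close> leaves countably many of them.
  The map \<open>\<sigma>\<close> recovers the random parameter from a point of the observed system.\<close>

lemma AE_recurrence_rates:
  assumes covered: "covered_polynomially d (UNIV :: 'x set)"
    and orbit: "\<And>z k. z \<in> space M \<Longrightarrow> \<pi> ((F ^^ k) z) = rds_iter \<theta> T k (\<sigma> z) (\<pi> z)"
  shows "AE z in M. 0 < lower_local_dim \<mu> (\<pi> z) \<longrightarrow>
     lower_recurrence_rate \<theta> T (\<sigma> z) (\<pi> z) = lower_local_dim \<mu> (\<pi> z) \<and>
     upper_recurrence_rate \<theta> T (\<sigma> z) (\<pi> z) = upper_local_dim \<mu> (\<pi> z)"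
proof -
  let ?e = "\<lambda>j. 1 / real (Suc j)"
  have "AE z in M. \<forall>p j. eventually (\<lambda>n. z \<notin> late_return (?e j) p ((1/5) ^ n)) sequentially"
    unfolding AE_all_countable by (intro allI AE_return_soon) simp
  moreover have "AE z in M. \<forall>j. eventually (\<lambda>n. z \<notin> early_return (?e j) (real d + 1) ((1/5) ^ n)) sequentially"
    unfolding AE_all_countable by (intro allI AE_no_early_return) auto
  moreover note AE_measure_ball_ge[OF covered] AE_space
  ultimately show ?thesis
  proof eventually_elim
    case (elim z)
    define x where "x = \<pi> z"
    define \<omega> where "\<omega> = \<sigma> z"
    interpret ball_growth \<mu> x "real d + 1"
      using elim(3) sets_\<mu> \<mu>.prob_space_axioms unfolding x_def by unfold_locales auto
    have orb: "\<pi> ((F ^^ k) z) = rds_iter \<theta> T k \<omega> x" for k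
      unfolding x_def \<omega>_def using elim(4) by (rule orbit)
    have soon: "eventually (\<lambda>n. \<exists>k>p. real k \<le> real (Suc p) * (((1/5) ^ n) powr - ?e j / mass ((1/5) ^ n)) \<and>
       dist (rds_iter \<theta> T k \<omega> x) x < 2 * (1/5) ^ n) sequentially" for p j
      using elim(1)[rule_format, of j p]
    proof eventually_elim
      case (elim n)
      have "0 < measure \<mu> (ball (\<pi> z) ((1/5) ^ n))" using mass_pos[of "(1/5) ^ n"] unfolding mass_def unfolding x_def by simp
      then obtain i where i: "1 \<le> i" "real i \<le> ((1/5) ^ n) powr - ?e j / mass ((1/5) ^ n)"
        "dist (\<pi> ((F ^^ (Suc p * i)) z)) (\<pi> z) < 2 * (1/5) ^ n"
        using elim \<open>z \<in> space M\<close> unfolding late_return_def mass_def unfolding x_def by (auto simp: not_le)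
      have "real (Suc p * i) \<le> real (Suc p) * (((1/5) ^ n) powr - ?e j / mass ((1/5) ^ n))"
        unfolding of_nat_mult using i(2) by (rule mult_left_mono) simp
      moreover have "p < Suc p * i" using i(1) by (cases i) auto
      ultimately show ?case using i(3) unfolding orb x_def[symmetric] by blast
    qed
    have late: "eventually (\<lambda>n. steady_scale (?e j) n \<longrightarrow>
      (\<forall>k. ((1/5) ^ n) powr - ?e j \<le> real k \<and> real k \<le> ((1/5) ^ n) powr (2 * ?e j) / mass (5 * (1/5) ^ n) \<longrightarrow>
         (1/5) ^ n \<le> dist (rds_iter \<theta> T k \<omega> x) x)) sequentially" for j
      using elim(2)[rule_format, of j] elim(3)
    proof eventually_elim
      case (elim n)
      show ?case
      proof (intro impI allI)
        fix k assume steady: "steady_scale (?e j) n"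
          and k: "((1/5) ^ n) powr - ?e j \<le> real k \<and> real k \<le> ((1/5) ^ n) powr (2 * ?e j) / mass (5 * (1/5) ^ n)"
        show "(1/5) ^ n \<le> dist (rds_iter \<theta> T k \<omega> x) x"
        proof (rule ccontr)
          assume "\<not> (1/5) ^ n \<le> dist (rds_iter \<theta> T k \<omega> x) x"
          then have "dist (\<pi> ((F ^^ k) z)) (\<pi> z) < (1/5) ^ n" unfolding orb x_def[symmetric] by linarith
          then have "z \<in> early_return (?e j) (real d + 1) ((1/5) ^ n)"
            using steady k elim(2) \<open>z \<in> space M\<close>
            unfolding early_return_def steady_scale_def mass_def unfolding x_def by blast
          then show False using elim(1) by blast
        qed
      qed
    qed
    show ?case
      using recurrence_rates_le[OF soon] recurrence_rates_ge[OF late]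
      unfolding x_def[symmetric] \<omega>_def[symmetric] by (auto intro: antisym)
  qed
qed

end

text \<open>The iterated integral in the decay hypothesis is an integral over \<open>P \<Otimes>\<^sub>M \<mu>\<close> by Fubini, since Lipschitz
  functions on a compact space are bounded.\<close>

lemma rds_rapidly_mixing_observed_system:
  fixes P :: "'w::metric_space measure" and \<mu> :: "'x::metric_space measure"
  assumes X: "compact (UNIV :: 'x set)" and rds: "random_dynamical_system P \<theta> T"
    and stat: "stationary_measure P \<theta> T \<mu>" and decay: "super_polynomial_decay P \<theta> T \<mu>"
  obtains \<delta> where "rapidly_mixing_observed_system (P \<Otimes>\<^sub>M \<mu>) (skew_product \<theta> T) snd \<mu> \<delta>"
proof -
  interpret P: prob_space P using rds unfolding random_dynamical_system_def by blast
  interpret Q: prob_space \<mu> using stat unfolding stationary_measure_def by blast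
  interpret pair: pair_prob_space P \<mu> ..
  have sets_\<mu>[measurable_cong]: "sets \<mu> = sets borel" using stat unfolding stationary_measure_def by blast
  have [measurable]: "\<theta> \<in> measurable P P" using rds unfolding random_dynamical_system_def by blast
  have "(\<lambda>(\<omega>, x). T \<omega> x) \<in> measurable (P \<Otimes>\<^sub>M borel) borel"
    using rds unfolding random_dynamical_system_def by blast
  then have T[measurable]: "(\<lambda>(\<omega>, x). T \<omega> x) \<in> measurable (P \<Otimes>\<^sub>M \<mu>) \<mu>"
    using measurable_cong_sets[OF sets_pair_measure_cong[OF refl sets_\<mu>] sets_\<mu>] by blast
  have S: "skew_product \<theta> T \<in> measurable (P \<Otimes>\<^sub>M \<mu>) (P \<Otimes>\<^sub>M \<mu>)"
    unfolding skew_product_def by measurable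
  have snd_borel[measurable]: "snd \<in> borel_measurable (P \<Otimes>\<^sub>M \<mu>)"
    using measurable_snd[of P \<mu>] measurable_cong_sets[OF refl sets_\<mu>] by blast
  have Sn[measurable]: "skew_product \<theta> T ^^ n \<in> measurable (P \<Otimes>\<^sub>M \<mu>) (P \<Otimes>\<^sub>M \<mu>)" for n
    using S by (rule measurable_compose_n)
  interpret observed: observed_system "P \<Otimes>\<^sub>M \<mu>" "skew_product \<theta> T" snd \<mu>
  proof unfold_locales
    show "distr (P \<Otimes>\<^sub>M \<mu>) \<mu> snd = \<mu>" 
    proof (rule measure_eqI)
      fix B assume "B \<in> sets (distr (P \<Otimes>\<^sub>M \<mu>) \<mu> snd)"
      then have B: "B \<in> sets \<mu>" by simp
      have "snd -` B \<inter> space (P \<Otimes>\<^sub>M \<mu>) = space P \<times> B"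
        using sets.sets_into_space[OF B] by (auto simp: space_pair_measure)
      then show "emeasure (distr (P \<Otimes>\<^sub>M \<mu>) \<mu> snd) B = emeasure \<mu> B"
        using B by (simp add: emeasure_distr Q.emeasure_pair_measure_Times P.emeasure_space_1)
    qed simp
    show "distr (P \<Otimes>\<^sub>M \<mu>) (P \<Otimes>\<^sub>M \<mu>) (skew_product \<theta> T) = P \<Otimes>\<^sub>M \<mu>"
      using stat unfolding stationary_measure_def by blast
  qed (use X S sets_\<mu> in auto)
  obtain \<delta> where rate: "\<And>q. q > 0 \<Longrightarrow> (\<lambda>n. \<delta> n * real n powr q) \<longlonglongrightarrow> 0"
    and cor: "\<And>n \<psi> \<phi>. n \<ge> 1 \<Longrightarrow> is_lipschitz \<psi> \<Longrightarrow> is_lipschitz \<phi> \<Longrightarrow>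
       \<bar>(\<integral>x. (\<integral>\<omega>. \<psi> (rds_iter \<theta> T n \<omega> x) * \<phi> x \<partial>P) \<partial>\<mu>) - (\<integral>x. \<psi> x \<partial>\<mu>) * (\<integral>x. \<phi> x \<partial>\<mu>)\<bar>
             \<le> lipschitz_norm \<psi> * lipschitz_norm \<phi> * \<delta> n"
    using decay unfolding super_polynomial_decay_def by blast
  have "rapidly_mixing_observed_system (P \<Otimes>\<^sub>M \<mu>) (skew_product \<theta> T) snd \<mu> \<delta>"
  proof unfold_locales
    fix n :: nat and \<psi> \<phi> :: "'x \<Rightarrow> real"
    assume n: "n \<ge> 1" and lip: "is_lipschitz \<psi>" "is_lipschitz \<phi>"
    note [measurable] = is_lipschitz_measurable[OF lip(1)] is_lipschitz_measurable[OF lip(2)]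
    obtain B where B: "\<And>x. \<bar>\<psi> x\<bar> \<le> B" using is_lipschitz_bounded[OF X lip(1)] by blast
    obtain B' where B': "\<And>x. \<bar>\<phi> x\<bar> \<le> B'" using is_lipschitz_bounded[OF X lip(2)] by blast
    let ?f = "\<lambda>z. \<psi> (snd ((skew_product \<theta> T ^^ n) z)) * \<phi> (snd z)"
    have eq: "?f = (\<lambda>(\<omega>, x). \<psi> (rds_iter \<theta> T n \<omega> x) * \<phi> x)"
      by (auto simp: skew_product_funpow)
    have "integrable (P \<Otimes>\<^sub>M \<mu>) ?f"
    proof (rule pair.P.integrable_const_bound[where B = "B * B'"])
      show "AE z in P \<Otimes>\<^sub>M \<mu>. norm (?f z) \<le> B * B'"
        using B B' by (intro AE_I2) (auto simp: abs_mult intro!: mult_mono order_trans[OF abs_ge_zero])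
    qed measurable
    then have "(\<integral>x. (\<integral>\<omega>. \<psi> (rds_iter \<theta> T n \<omega> x) * \<phi> x \<partial>P) \<partial>\<mu>) = (\<integral>z. ?f z \<partial>(P \<Otimes>\<^sub>M \<mu>))"
      unfolding eq by (rule pair.integral_snd)
    then show "\<bar>(\<integral>z. ?f z \<partial>(P \<Otimes>\<^sub>M \<mu>)) - (\<integral>x. \<psi> x \<partial>\<mu>) * (\<integral>x. \<phi> x \<partial>\<mu>)\<bar>
        \<le> lipschitz_norm \<psi> * lipschitz_norm \<phi> * \<delta> n"
      using cor[OF n lip] by simp
  qed (rule rate)
  then show ?thesis using that by blast
qed

theorem theorem10:
  fixes A :: "('x::metric_space, 'e::euclidean_space) chart set"
    and g :: "('x, 'e) chart \<Rightarrow> 'e \<Rightarrow> 'e \<Rightarrow> 'e \<Rightarrow> real"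
    and P :: "'w::metric_space measure"
    and \<theta> :: "'w \<Rightarrow> 'w"
    and T :: "'w \<Rightarrow> 'x \<Rightarrow> 'x"
    and \<mu> :: "'x measure"
  assumes "compact_riemannian_manifold A g"
    and "random_dynamical_system P \<theta> T"
    and "stationary_measure P \<theta> T \<mu>"
    and "super_polynomial_decay P \<theta> T \<mu>"
  shows "AE (\<omega>, x) in P \<Otimes>\<^sub>M \<mu>. lower_local_dim \<mu> x > 0 \<longrightarrow>
           lower_recurrence_rate \<theta> T \<omega> x = lower_local_dim \<mu> x \<and>
           upper_recurrence_rate \<theta> T \<omega> x = upper_local_dim \<mu> x"
proof -
  have "compact (UNIV :: 'x set)" using assms(1) unfolding compact_riemannian_manifold_def by blast
  then obtain \<delta> where "rapidly_mixing_observed_system (P \<Otimes>\<^sub>M \<mu>) (skew_product \<theta> T) snd \<mu> \<delta>"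
    using rds_rapidly_mixing_observed_system assms(2-4) by blast
  then interpret rapidly_mixing_observed_system "P \<Otimes>\<^sub>M \<mu>" "skew_product \<theta> T" snd \<mu> \<delta> .
  show ?thesis
    using AE_recurrence_rates[OF manifold_covered_polynomially[OF assms(1)], of \<theta> T fst]
    by (auto simp: skew_product_funpow case_prod_beta)
qed

end
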